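(* Let $V$ be a finite-dimensional complex vector space and $\mathfrak g(V)$ one of $\mathfrak{sl}(V)$, $\mathfrak{sp}(V)$, $\mathfrak{so}(V)$. Let $\phi:\mathfrak{sl}_2\oplus\mathfrak{sl}_2\to\mathfrak g(V)$ be a Lie algebra homomorphism, let $e_1,e_2$ be the images of the standard nilpotent generators $e$ of the first and second factor, and suppose that as a module over $\mathfrak{sl}_2\oplus\mathfrak{sl}_2$, $$V\cong\bigoplus_{i=1}^{p}R(n_i-1)\otimes R(m_i-1),$$ where $R(d)$ denotes the irreducible $\mathfrak{sl}_2$-module of dimension $d+1$. Let $\mathfrak J=\{(n_i,m_i):i=1,\dots,p\}$ (a multiset). Then $(e_1,e_2)$ is a principal nilpotent pair in $\mathfrak g(V)$ if and only if: (i) for $\mathfrak{sl}(V)$: $p=1$; (ii) for $\mathfrak{sp}(V)$: $p=1$ and $n_1,m_1$ have different parity; (iii) for $\mathfrak{so}(V)$: either $p=1$ and $n_1,m_1$ have the same parity, or $p=2$ and $\mathfrak J=\{(n,m),(1,1)\}$ or $\mathfrak J=\{(n,1),(1,m)\}$ with $n,m$ both odd.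
   Context: For a complex semisimple Lie algebra $\mathfrak g$ with adjoint group $G$, a principal nilpotent pair is a pair $(e_1,e_2)\in\mathfrak g\oplus\mathfrak g$ with $[e_1,e_2]=0$, $\dim\mathfrak z(e_1,e_2)=\operatorname{rk}\mathfrak g$ (where $\mathfrak z(e_1,e_2)$ is the simultaneous centralizer in $\mathfrak g$), and such that for every $(t_1,t_2)\in(\mathbb C^* )^2$ there is $g\in G$ with $\operatorname{Ad}g(e_i)=t_ie_i$. *)

theory Defs
  imports "HOL-Analysis.Analysis" "HOL-Library.Multiset"
begin

text \<open>V = complex^'n (an arbitrary finite-dimensional complex space, dim = CARD('n));
  gl(V) = complex^'n^'n.\<close>

type_synonym 'n cmat = "complex^'n^'n"

definition mscale :: "complex \<Rightarrow> 'n::finite cmat \<Rightarrow> 'n cmat" where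
  "mscale c A = (\<chi> i j. c * A $ i $ j)"

definition bracket :: "'n::finite cmat \<Rightarrow> 'n cmat \<Rightarrow> 'n cmat" where
  "bracket X Y = X ** Y - Y ** X"

definition cdim :: "'n::finite cmat set \<Rightarrow> nat" where
  "cdim S = vector_space.dim mscale S"

definition centralizer :: "'n::finite cmat set \<Rightarrow> 'n cmat set \<Rightarrow> 'n cmat set" where
  "centralizer L S = {X \<in> L. \<forall>Y\<in>S. bracket X Y = 0}"

text \<open>Rank of a (reductive) linear Lie algebra: dimension of the centralizer of a
  regular element, i.e. the minimum of dim z(x) over x in L.\<close>
definition lie_rank :: "'n::finite cmat set \<Rightarrow> nat" where
  "lie_rank L = Min ((\<lambda>x. cdim (centralizer L {x})) ` L)"

datatype classical = SL | SP | SO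

text \<open>Admissible forms: for sp(V) a nondegenerate skew form, for so(V) a nondegenerate
  symmetric form, given by its Gram matrix B (the form is (u,w) \<mapsto> u^T B w).
  For sl(V) no form is used.\<close>
definition admissible_form :: "classical \<Rightarrow> 'n::finite cmat \<Rightarrow> bool" where
  "admissible_form k B = (case k of
      SL \<Rightarrow> True
    | SP \<Rightarrow> invertible B \<and> transpose B = - B
    | SO \<Rightarrow> invertible B \<and> transpose B = B)"

definition lie_alg :: "classical \<Rightarrow> 'n::finite cmat \<Rightarrow> 'n cmat set" where
  "lie_alg k B = (case k of
      SL \<Rightarrow> {X. trace X = 0}
    | SP \<Rightarrow> {X. transpose X ** B + B ** X = 0}
    | SO \<Rightarrow> {X. transpose X ** B + B ** X = 0})"

text \<open>A connected matrix group G with Lie algebra g(V): SL(V), Sp(V), SO(V).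
  Its image under Ad is the adjoint group of g(V).\<close>
definition lie_grp :: "classical \<Rightarrow> 'n::finite cmat \<Rightarrow> 'n cmat set" where
  "lie_grp k B = (case k of
      SL \<Rightarrow> {g. det g = 1}
    | SP \<Rightarrow> {g. transpose g ** B ** g = B}
    | SO \<Rightarrow> {g. transpose g ** B ** g = B \<and> det g = 1})"

definition Ad :: "'n::finite cmat \<Rightarrow> 'n cmat \<Rightarrow> 'n cmat" where
  "Ad g X = g ** X ** matrix_inv g"

definition principal_nilpotent_pair ::
  "'n::finite cmat set \<Rightarrow> 'n cmat set \<Rightarrow> 'n cmat \<Rightarrow> 'n cmat \<Rightarrow> bool" where
  "principal_nilpotent_pair L G e1 e2 \<longleftrightarrow>
     e1 \<in> L \<and> e2 \<in> L \<and> bracket e1 e2 = 0 \<and>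
     cdim (centralizer L {e1, e2}) = lie_rank L \<and>
     (\<forall>t1 t2. t1 \<noteq> 0 \<and> t2 \<noteq> 0 \<longrightarrow>
        (\<exists>g\<in>G. Ad g e1 = mscale t1 e1 \<and> Ad g e2 = mscale t2 e2))"

definition sl2_triple :: "'n::finite cmat \<Rightarrow> 'n cmat \<Rightarrow> 'n cmat \<Rightarrow> bool" where
  "sl2_triple E H F \<longleftrightarrow>
     bracket H E = mscale 2 E \<and> bracket H F = mscale (-2) F \<and> bracket E F = H"

text \<open>A Lie algebra homomorphism sl2 \<oplus> sl2 \<rightarrow> L, given by the images of the standard
  bases (e,h,f) of the two factors.\<close>
definition sl2sl2_hom :: "'n::finite cmat set \<Rightarrow> 'n cmat \<Rightarrow> 'n cmat \<Rightarrow> 'n cmat \<Rightarrow>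
     'n cmat \<Rightarrow> 'n cmat \<Rightarrow> 'n cmat \<Rightarrow> bool" where
  "sl2sl2_hom L E1 H1 F1 E2 H2 F2 \<longleftrightarrow>
     {E1, H1, F1, E2, H2, F2} \<subseteq> L \<and> sl2_triple E1 H1 F1 \<and> sl2_triple E2 H2 F2 \<and>
     (\<forall>X\<in>{E1, H1, F1}. \<forall>Y\<in>{E2, H2, F2}. bracket X Y = 0)"

text \<open>Index set of the standard basis of the module
  \<Oplus>_i R(n_i - 1) \<otimes> R(m_i - 1), for J = [(n_1,m_1),...,(n_p,m_p)].\<close>
definition mod_index :: "(nat \<times> nat) list \<Rightarrow> (nat \<times> nat \<times> nat) set" where
  "mod_index J = {(i, a, b). i < length J \<and> a < fst (J ! i) \<and> b < snd (J ! i)}"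

text \<open>Standard model of R(d) (d = n - 1), basis v_0..v_d:
   h v_k = (d - 2k) v_k, f v_k = v_(k+1) (v_(d+1) = 0), e v_k = k(d-k+1) v_(k-1).
  V is isomorphic, as sl2 \<oplus> sl2-module via the operators (E1,H1,F1), (E2,H2,F2),
  to \<Oplus>_i R(n_i-1) \<otimes> R(m_i-1) iff V has a basis v_(i,a,b) on which the operators act
  as on the basis v_a \<otimes> w_b of the i-th summand.\<close>
definition decomposes_as ::
  "'n::finite cmat \<Rightarrow> 'n cmat \<Rightarrow> 'n cmat \<Rightarrow> 'n cmat \<Rightarrow> 'n cmat \<Rightarrow> 'n cmat \<Rightarrow>
   (nat \<times> nat) list \<Rightarrow> bool" where
  "decomposes_as E1 H1 F1 E2 H2 F2 J \<longleftrightarrow>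
     (\<forall>(n, m) \<in> set J. 1 \<le> n \<and> 1 \<le> m) \<and>
     (\<exists>v :: nat \<times> nat \<times> nat \<Rightarrow> complex^'n.
        inj_on v (mod_index J) \<and>
        vec.independent (v ` mod_index J) \<and>
        vec.span (v ` mod_index J) = UNIV \<and>
        (\<forall>(i, a, b) \<in> mod_index J.
           let n = fst (J ! i); m = snd (J ! i) in
           H1 *v v (i, a, b) = of_int (int n - 1 - 2 * int a) *s v (i, a, b) \<and>
           F1 *v v (i, a, b) = (if a + 1 < n then v (i, a + 1, b) else 0) \<and>
           E1 *v v (i, a, b) = (if a = 0 then 0 else of_nat (a * (n - a)) *s v (i, a - 1, b)) \<and>
           H2 *v v (i, a, b) = of_int (int m - 1 - 2 * int b) *s v (i, a, b) \<and>
           F2 *v v (i, a, b) = (if b + 1 < m then v (i, a, b + 1) else 0) \<and>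
           E2 *v v (i, a, b) = (if b = 0 then 0 else of_nat (b * (m - b)) *s v (i, a, b - 1))))"

definition pnp_condition :: "classical \<Rightarrow> (nat \<times> nat) list \<Rightarrow> bool" where
  "pnp_condition k J = (case k of
      SL \<Rightarrow> length J = 1
    | SP \<Rightarrow> length J = 1 \<and> (even (fst (J ! 0)) \<noteq> even (snd (J ! 0)))
    | SO \<Rightarrow> (length J = 1 \<and> (even (fst (J ! 0)) = even (snd (J ! 0)))) \<or>
            (length J = 2 \<and> (\<exists>n m. odd n \<and> odd m \<and>
               (mset J = {#(n, m), (1, 1)#} \<or> mset J = {#(n, 1), (1, m)#}))))"

end

theory Submission
  imports Defs "HOL-Computational_Algebra.Polynomial"
begin

text \<open>
  The elements \<open>s\<^sub>1 ^ H1 * s\<^sub>2 ^ H2\<close> lie in the group and rescale \<open>E1\<close> and \<open>E2\<close> arbitrarily, so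
  only the dimension condition matters.

  Rank. If \<open>x\<close> has a cyclic vector, its centralizer in \<open>gl(V)\<close> consists of the polynomials in \<open>x\<close>,
  and in \<open>so(V)\<close> or \<open>sp(V)\<close> of the odd ones. Cyclicity is a nonvanishing determinant, hence generic on
  every line through a cyclic element, and centralizer dimensions are upper semicontinuous; so the
  rank is \<open>N - 1\<close> for \<open>sl\<close> and \<open>N div 2\<close> for \<open>so\<close> and \<open>sp\<close>, where \<open>N = dim V\<close>. A hyperbolic basis
  provides an element of \<open>so(V)\<close> or \<open>sp(V)\<close> with distinct eigenvalues.

  Centralizer of the pair. The map \<open>X \<mapsto> B X\<close> identifies the centralizer of \<open>(E1, E2)\<close> with the
  skew (for \<open>so\<close>) or symmetric (for \<open>sp\<close>) bilinear forms for which \<open>E1\<close> and \<open>E2\<close> are skew; this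
  space no longer depends on \<open>B\<close>. As a module over \<open>\<complex>[E1, E2]\<close>, \<open>V\<close> is a sum of cyclic modules
  \<open>\<complex>[x, y] / (x ^ n, y ^ m)\<close> with generators \<open>g\<^sub>i\<close>, and such a form satisfies
  \<open>Y(x ^ a y ^ b g\<^sub>i, x ^ c y ^ d g\<^sub>j) = (-1) ^ (a + b) f\<^sub>i\<^sub>j(a + c, b + d)\<close> with \<open>f\<^sub>i\<^sub>j\<close> arbitrary on a
  \<open>min n\<^sub>i n\<^sub>j \<times> min m\<^sub>i m\<^sub>j\<close> rectangle for \<open>i < j\<close> and supported on the \<open>(s, t)\<close> with \<open>s + t\<close> of one
  fixed parity for \<open>i = j\<close>. Counting these parameters and comparing with the rank gives the theorem.
\<close>

section \<open>Matrices as a complex vector space; dimensions by dual functionals\<close>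

lemma mscale_nth [simp]: "mscale c A $ i $ j = c * A $ i $ j"
  by (simp add: mscale_def)

lemma mat_eqI: "(\<And>i j. A $ i $ j = B $ i $ j) \<Longrightarrow> A = (B :: 'a^'n^'m)"
  by (simp add: vec_eq_iff)

definition matrix_unit :: "'n::finite \<Rightarrow> 'n \<Rightarrow> 'n cmat" where
  "matrix_unit i j = (\<chi> k l. if k = i \<and> l = j then 1 else 0)"

lemma vector_space_mscale: "vector_space (mscale :: complex \<Rightarrow> 'n::finite cmat \<Rightarrow> 'n cmat)"
  by unfold_locales (auto intro!: mat_eqI simp: algebra_simps)

text \<open>Applying \<open>f k\<close> to a combination of the \<open>b l\<close> reads off its
  coefficient at \<open>k\<close>, so a vanishing combination has only zero coefficients.\<close>

lemma (in vector_space) dual_functionals_independent: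
  assumes "finite K"
    and add: "\<And>k x y. k \<in> K \<Longrightarrow> f k (x + y) = f k x + f k y"
    and scale: "\<And>k c x. k \<in> K \<Longrightarrow> f k (scale c x) = c * f k x"
    and dual: "\<And>k l. k \<in> K \<Longrightarrow> l \<in> K \<Longrightarrow> f k (b l) = (if k = l then 1 else 0)"
  shows "inj_on b K" "independent (b ` K)"
    "k \<in> K \<Longrightarrow> f k (\<Sum>l\<in>K. scale (c l) (b l)) = c k"
proof -
  have zero: "f k 0 = 0" if "k \<in> K" for k
    using scale[OF that, of 0 0] by simp
  have fsum: "f k (\<Sum>l\<in>L. scale (c l) (b l)) = (\<Sum>l\<in>L. c l * f k (b l))" if "k \<in> K" for k c L
    by (induction L rule: infinite_finite_induct) (simp_all add: zero add scale that)
  have coeff: "f k (\<Sum>l\<in>K. scale (c l) (b l)) = c k" if "k \<in> K" for k c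
  proof -
    have "(\<Sum>l\<in>K. c l * f k (b l)) = (\<Sum>l\<in>K. if k = l then c l else 0)"
      by (rule sum.cong) (auto simp: dual that)
    then show ?thesis
      using that \<open>finite K\<close> by (simp add: fsum)
  qed
  show inj: "inj_on b K"
    by (rule inj_onI) (metis dual zero_neq_one)
  show "independent (b ` K)"
  proof (rule independent_if_scalars_zero)
    show "finite (b ` K)"
      using \<open>finite K\<close> by simp
  next
    fix g x assume sum: "(\<Sum>x\<in>b ` K. scale (g x) x) = 0" and x: "x \<in> b ` K"
    then obtain k where k: "k \<in> K" "x = b k"
      by auto
    have "(\<Sum>l\<in>K. scale (g (b l)) (b l)) = 0"
      using sum by (simp add: sum.reindex[OF inj])
    then show "g x = 0"
      using coeff[OF k(1), of "\<lambda>l. g (b l)"] zero k by simp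
  qed
  show "k \<in> K \<Longrightarrow> f k (\<Sum>l\<in>K. scale (c l) (b l)) = c k"
    by (rule coeff)
qed

text \<open>The source of every centralizer dimension below. Subtracting from \<open>x\<close> the
  combination of the \<open>b l\<close> with coefficients \<open>f l x\<close> leaves a vector of
  \<open>S\<close> that all functionals kill, hence zero by \<open>sep\<close>; so the
  \<open>b l\<close> form a basis of \<open>S\<close>.\<close>

lemma (in vector_space) dim_eq_card_dual_functionals:
  assumes "finite K" "subspace S"
    and add: "\<And>k x y. k \<in> K \<Longrightarrow> f k (x + y) = f k x + f k y"
    and scale: "\<And>k c x. k \<in> K \<Longrightarrow> f k (scale c x) = c * f k x"
    and dual: "\<And>k l. k \<in> K \<Longrightarrow> l \<in> K \<Longrightarrow> f k (b l) = (if k = l then 1 else 0)"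
    and bS: "\<And>k. k \<in> K \<Longrightarrow> b k \<in> S"
    and sep: "\<And>x. x \<in> S \<Longrightarrow> (\<And>k. k \<in> K \<Longrightarrow> f k x = 0) \<Longrightarrow> x = 0"
  shows "S = span (b ` K)" "dim S = card K"
proof -
  have dl: "inj_on b K" "independent (b ` K)"
    "\<And>k c. k \<in> K \<Longrightarrow> f k (\<Sum>l\<in>K. scale (c l) (b l)) = c k"
    by (rule dual_functionals_independent[where f = f]; use assms(1,3-5) in blast)+
  have "x \<in> span (b ` K)" if x: "x \<in> S" for x
  proof -
    define y where "y = (\<Sum>l\<in>K. scale (f l x) (b l))"
    have yS: "y \<in> S"
      unfolding y_def by (intro subspace_sum subspace_scale bS \<open>subspace S\<close>)
    have "f k (x - y) = 0" if k: "k \<in> K" for k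
    proof -
      have "f k (x - y + y) = f k (x - y) + f k y"
        by (rule add[OF k])
      moreover have "f k y = f k x"
        unfolding y_def using dl(3)[OF k] by simp
      ultimately show ?thesis by simp
    qed
    then have "x - y = 0"
      by (intro sep subspace_diff x yS \<open>subspace S\<close>)
    then have "x = y" by simp
    moreover have "y \<in> span (b ` K)"
      unfolding y_def by (intro span_sum span_scale span_base) auto
    ultimately show ?thesis by simp
  qed
  moreover have "span (b ` K) \<subseteq> S"
    using bS by (intro span_minimal \<open>subspace S\<close>) auto
  ultimately show S: "S = span (b ` K)"
    by auto
  show "dim S = card K"
    unfolding S using dl(1,2) by (simp add: dim_eq_card_independent card_image)
qed

lemma finite_dimensional_mscale:
  "finite_dimensional_vector_space mscale ((\<lambda>(i, j). matrix_unit i j) ` (UNIV :: ('n::finite \<times> 'n) set))"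
proof -
  interpret vs: vector_space "mscale :: complex \<Rightarrow> 'n cmat \<Rightarrow> 'n cmat"
    by (rule vector_space_mscale)
  let ?b = "\<lambda>(i, j). matrix_unit i j :: 'n cmat"
  let ?f = "\<lambda>(i, j) (A :: 'n cmat). A $ i $ j"
  have dual: "?f k (?b l) = (if k = l then 1 else 0)" for k l
    by (auto simp: matrix_unit_def split: prod.splits)
  have "vs.independent (?b ` UNIV)"
    by (rule vs.dual_functionals_independent(2)[where f = ?f]) (auto simp: dual)
  moreover have "UNIV = vs.span (?b ` UNIV)"
    by (rule vs.dim_eq_card_dual_functionals(1)[where f = ?f])
       (auto simp: dual intro!: mat_eqI)
  ultimately show ?thesis
    by unfold_locales auto
qed

interpretation mat: finite_dimensional_vector_space "mscale :: complex \<Rightarrow> 'n::finite cmat \<Rightarrow> 'n cmat"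
  "(\<lambda>(i, j). matrix_unit i j) ` UNIV"
  by (rule finite_dimensional_mscale)

lemma cdim_eq: "cdim S = mat.dim S"
  by (simp add: cdim_def)

section \<open>Frames and bilinear forms\<close>

text \<open>A basis as an indexed family: independence together with the right number of vectors.
  Indexing keeps track of which coefficient belongs to which vector.\<close>

definition frame :: "'i set \<Rightarrow> ('i \<Rightarrow> complex^'n::finite) \<Rightarrow> bool" where
  "frame I v \<longleftrightarrow> finite I \<and> card I = CARD('n) \<and>
     (\<forall>c. (\<Sum>k\<in>I. c k *s v k) = 0 \<longrightarrow> (\<forall>k\<in>I. c k = 0))"

lemma mult_vec_axis: "(A :: 'a::semiring_1^'n::finite^'m) *v axis j 1 = (\<chi> i. A $ i $ j)"
  by (simp add: vec_eq_iff matrix_vector_mult_def axis_def if_distrib cong: if_cong)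

lemma sum_vec_eq_mult: "(\<Sum>j\<in>UNIV. c j *s e j) = (\<chi> i j. e j $ i) *v (\<chi> j. (c j :: complex))"
  by (simp add: vec_eq_iff matrix_vector_mult_def mult.commute)

text \<open>Independence of the columns is left invertibility of the square matrix. This turns being
  a frame into the nonvanishing of a determinant.\<close>

lemma invertible_frame_matrix:
  fixes v :: "'i \<Rightarrow> complex^'n::finite"
  assumes b: "bij_betw b (UNIV :: 'n set) I"
  shows "frame I v \<longleftrightarrow> invertible (\<chi> i j. v (b j) $ i)" (is "_ \<longleftrightarrow> invertible ?P")
proof -
  have I: "finite I" "card I = CARD('n)"
    using b bij_betw_finite[OF b] bij_betw_same_card[OF b] by auto
  have sum: "(\<Sum>k\<in>I. c k *s v k) = (\<Sum>j\<in>UNIV. c (b j) *s v (b j))" for c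
    by (rule sum.reindex_bij_betw[OF b, symmetric])
  have inv: "(\<forall>c. (\<Sum>j\<in>UNIV. c j *s v (b j)) = 0 \<longrightarrow> (\<forall>j. c j = 0)) \<longleftrightarrow> invertible ?P"
    unfolding invertible_left_inverse matrix_left_invertible_independent_columns
    by (simp add: column_def)
  have "(\<forall>c. (\<Sum>k\<in>I. c k *s v k) = 0 \<longrightarrow> (\<forall>k\<in>I. c k = 0)) \<longleftrightarrow>
    (\<forall>c. (\<Sum>j\<in>UNIV. c j *s v (b j)) = 0 \<longrightarrow> (\<forall>j. c j = 0))" (is "?l \<longleftrightarrow> ?r")
  proof
    assume l: ?l
    show ?r
    proof (intro allI impI)
      fix c :: "'n \<Rightarrow> complex" and j
      assume "(\<Sum>j\<in>UNIV. c j *s v (b j)) = 0"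
      moreover have inj: "c (inv_into UNIV b (b j)) = c j" for j
        using b by (simp add: bij_betw_def)
      ultimately have "(\<Sum>k\<in>I. c (inv_into UNIV b k) *s v k) = 0"
        by (simp add: sum[of "\<lambda>k. c (inv_into UNIV b k)"])
      then have "\<forall>k\<in>I. c (inv_into UNIV b k) = 0"
        using l by (elim allE[of _ "\<lambda>k. c (inv_into UNIV b k)"]) blast
      then show "c j = 0"
        using b inj[of j] by (metis bij_betw_apply UNIV_I)
    qed
  next
    assume r: ?r
    show ?l
    proof (intro allI impI ballI)
      fix c k assume s: "(\<Sum>k\<in>I. c k *s v k) = 0" and "k \<in> I"
      then obtain j where "k = b j"
        using b by (auto simp: bij_betw_def)
      then show "c k = 0"
        using s r by (auto simp: sum)
    qed
  qed
  then show ?thesis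
    using I inv by (simp add: frame_def)
qed

lemma frame_axis: "frame UNIV (\<lambda>j :: 'n::finite. axis j 1)"
  by (auto simp: frame_def basis_expansion vec_eq_iff axis_def if_distrib cong: if_cong)

lemma frame_bij:
  fixes v :: "'i \<Rightarrow> complex^'n::finite"
  assumes "frame I v"
  obtains b where "bij_betw b (UNIV :: 'n set) I"
proof -
  have "\<exists>b. bij_betw b (UNIV :: 'n set) I"
    using assms by (auto simp: frame_def intro!: finite_same_card_bij)
  then show ?thesis
    using that by blast
qed

lemma matrix_inv_inverse:
  assumes "invertible (A :: 'a::semiring_1^'n^'m)"
  shows "A ** matrix_inv A = mat 1" "matrix_inv A ** A = mat 1"
  using someI_ex[OF assms[unfolded invertible_def]] by (simp_all add: matrix_inv_def)

text \<open>Coordinates are obtained by applying the inverse of the column matrix, for some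
  enumeration of \<open>I\<close>. As an entry of a matrix-vector product the value is linear in
  \<open>u\<close> whether or not \<open>v\<close> is a frame.\<close>

definition frame_coord :: "'i set \<Rightarrow> ('i \<Rightarrow> complex^'n::finite) \<Rightarrow> 'i \<Rightarrow> complex^'n \<Rightarrow> complex" where
  "frame_coord I v k u = (let b = SOME b. bij_betw b (UNIV :: 'n set) I
     in (matrix_inv (\<chi> i j. v (b j) $ i) *v u) $ inv_into UNIV b k)"

lemma frame_coord_add: "frame_coord I v k (u + w) = frame_coord I v k u + frame_coord I v k w"
  and frame_coord_scale: "frame_coord I v k (a *s u) = a * frame_coord I v k u"
  by (simp_all add: frame_coord_def Let_def matrix_vector_right_distrib vector_scalar_commute)

lemma frame_coord:
  fixes v :: "'i \<Rightarrow> complex^'n::finite"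
  assumes fr: "frame I v"
  shows frame_coord_dual: "k \<in> I \<Longrightarrow> l \<in> I \<Longrightarrow> frame_coord I v k (v l) = (if k = l then 1 else 0)"
    and frame_expand: "(\<Sum>k\<in>I. frame_coord I v k u *s v k) = u"
proof -
  define b where "b = (SOME b. bij_betw b (UNIV :: 'n set) I)"
  have b: "bij_betw b UNIV I"
    unfolding b_def using frame_bij[OF fr] someI_ex[of "\<lambda>b. bij_betw b (UNIV :: 'n set) I"] by blast
  define P where "P = (\<chi> i j. v (b j) $ i)"
  define Q where "Q = matrix_inv P"
  have "invertible P"
    using fr invertible_frame_matrix[OF b] by (simp add: P_def)
  then have Q: "P ** Q = mat 1" "Q ** P = mat 1"
    by (simp_all add: Q_def matrix_inv_inverse)
  have fb: "frame_coord I v (b j) u = (Q *v u) $ j" for j u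
    using b unfolding frame_coord_def b_def[symmetric] Let_def P_def[symmetric] Q_def[symmetric]
    by (simp add: bij_betw_def)
  have PA: "P *v axis j 1 = v (b j)" for j
    by (simp add: P_def mult_vec_axis vec_eq_iff)
  have QA: "Q *v v (b j) = axis j 1" for j
    by (simp add: PA[symmetric] matrix_vector_mul_assoc Q)
  show "frame_coord I v k (v l) = (if k = l then 1 else 0)" if "k \<in> I" "l \<in> I" for k l
  proof -
    have "k \<in> range b" "l \<in> range b"
      using b that by (simp_all add: bij_betw_def)
    then obtain i j where "k = b i" "l = b j"
      by blast
    then show ?thesis
      using b by (auto simp: fb QA axis_def bij_betw_def inj_def)
  qed
  have "(\<Sum>k\<in>I. frame_coord I v k u *s v k) = (\<Sum>j\<in>UNIV. (Q *v u) $ j *s v (b j))"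
    by (subst sum.reindex_bij_betw[OF b, symmetric]) (simp add: fb)
  also have "\<dots> = P *v (Q *v u)"
    by (simp add: sum_vec_eq_mult P_def)
  also have "\<dots> = u"
    by (simp add: matrix_vector_mul_assoc Q)
  finally show "(\<Sum>k\<in>I. frame_coord I v k u *s v k) = u" .
qed

lemma mult_vec_sum: "A *v (\<Sum>k\<in>I. f k) = (\<Sum>k\<in>I. A *v f k :: complex^'n::finite)"
  by (induction I rule: infinite_finite_induct) (auto simp: matrix_vector_right_distrib)

lemma frame_ext:
  fixes A A' :: "complex^'n::finite^'m::finite"
  assumes "frame I v" "\<And>k. k \<in> I \<Longrightarrow> A *v v k = A' *v v k"
  shows "A = A'"
proof -
  let ?f = "frame_coord I v"
  have "A *v (\<Sum>k\<in>I. ?f k u *s v k) = A' *v (\<Sum>k\<in>I. ?f k u *s v k)" for u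
    by (simp add: mult_vec_sum vector_scalar_commute assms(2))
  then have "A *v u = A' *v u" for u
    by (simp only: frame_expand[OF assms(1)])
  then show ?thesis
    by (simp add: matrix_eq)
qed

lemma frame_prescribe:
  fixes v :: "'i \<Rightarrow> complex^'n::finite" and h :: "'i \<Rightarrow> complex^'m::finite"
  assumes "frame I v"
  obtains A where "\<And>k. k \<in> I \<Longrightarrow> A *v v k = h k"
proof -
  let ?f = "frame_coord I v"
  define g where "g u = (\<Sum>k\<in>I. ?f k u *s h k)" for u
  have "Vector_Spaces.linear (*s) (*s) g"
    unfolding Vector_Spaces.linear_def module_hom_def module_hom_axioms_def g_def
    by (auto simp: frame_coord_add frame_coord_scale vec.vector_space_axioms vec.module_axioms sum.distrib vector_sadd_rdistrib
        vec.scale_sum_right)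
  moreover have "g (v l) = h l" if "l \<in> I" for l
  proof -
    have "g (v l) = (\<Sum>k\<in>I. if k = l then h k else 0)"
      unfolding g_def using that by (intro sum.cong) (auto simp: frame_coord_dual[OF assms])
    then show ?thesis
      using that assms by (simp add: frame_def)
  qed
  ultimately show ?thesis
    using that[of "matrix g"] by (simp add: matrix_works)
qed

text \<open>With the frame as columns of \<open>P\<close>, the hypothesis reads
  \<open>A ** P = P ** D\<close> for a diagonal \<open>D\<close>, and \<open>det P\<close>
  cancels.\<close>

lemma frame_det_diag:
  fixes v :: "'i \<Rightarrow> complex^'n::finite"
  assumes fr: "frame I v" and A: "\<And>k. k \<in> I \<Longrightarrow> A *v v k = d k *s v k"
  shows "det A = (\<Prod>k\<in>I. d k)"
proof -
  obtain b where b: "bij_betw b (UNIV :: 'n set) I"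
    using frame_bij[OF fr] .
  define P where "P = (\<chi> i j. v (b j) $ i)"
  define D where "D = (\<chi> i j. if i = j then d (b i) else 0)"
  have "invertible P"
    using fr invertible_frame_matrix[OF b] by (simp add: P_def)
  then have "det P \<noteq> 0"
    by (simp add: invertible_det_nz)
  have PA: "P *v axis j 1 = v (b j)" for j
    by (simp add: P_def mult_vec_axis vec_eq_iff)
  have "A ** P = P ** D"
  proof (rule frame_ext)
    show "frame UNIV (\<lambda>j :: 'n. axis j 1)"
      by (rule frame_axis)
    fix j
    have "D *v axis j 1 = d (b j) *s axis j 1"
      unfolding mult_vec_axis by (auto simp: D_def vec_eq_iff axis_def)
    then show "(A ** P) *v axis j 1 = (P ** D) *v axis j 1"
      using A[of "b j"] b
      by (simp add: matrix_vector_mul_assoc[symmetric] PA vector_scalar_commute bij_betw_apply)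
  qed
  then have "det A * det P = det P * det D"
    by (metis det_mul)
  then have "det A = det D"
    using \<open>det P \<noteq> 0\<close> by simp
  also have "\<dots> = (\<Prod>j\<in>UNIV. d (b j))"
    by (subst det_diagonal) (auto simp: D_def)
  finally show ?thesis
    by (simp add: prod.reindex_bij_betw[OF b])
qed

section \<open>Bilinear forms given by Gram matrices\<close>

definition bil :: "'n::finite cmat \<Rightarrow> complex^'n \<Rightarrow> complex^'n \<Rightarrow> complex" where
  "bil Y u w = (\<Sum>i\<in>UNIV. u $ i * (Y *v w) $ i)"

lemma bil_add_left: "bil Y (u + u') w = bil Y u w + bil Y u' w"
  and bil_add_right: "bil Y u (w + w') = bil Y u w + bil Y u w'"
  and bil_scale_left: "bil Y (a *s u) w = a * bil Y u w"
  and bil_scale_right: "bil Y u (a *s w) = a * bil Y u w"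
  and bil_add_mat: "bil (Y + Z) u w = bil Y u w + bil Z u w"
  and bil_scale_mat: "bil (mscale a Y) u w = a * bil Y u w"
  and bil_uminus_mat: "bil (- Y) u w = - bil Y u w"
  by (simp_all add: bil_def matrix_vector_mult_def algebra_simps sum.distrib sum_distrib_left
      sum_negf)

lemma bil_zero [simp]: "bil Y 0 w = 0" "bil Y u 0 = 0" "bil 0 u w = 0"
  by (simp_all add: bil_def)

lemma bil_uminus_left: "bil Y (- u) w = - bil Y u w"
  and bil_uminus_right: "bil Y u (- w) = - bil Y u w"
  using bil_scale_left[of Y "-1" u w] bil_scale_right[of Y u "-1" w]
  by (simp_all add: vector_sneg_minus1[symmetric])

lemma bil_diff_left: "bil Y (u - u') w = bil Y u w - bil Y u' w"
  and bil_diff_right: "bil Y u (w - w') = bil Y u w - bil Y u w'"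
  using bil_add_left[of Y u "- u'" w] bil_add_right[of Y u w "- w'"]
  by (simp_all add: bil_uminus_left bil_uminus_right)

lemma bil_sum_left: "bil Y (\<Sum>k\<in>I. f k) w = (\<Sum>k\<in>I. bil Y (f k) w)"
  and bil_sum_right: "bil Y w (\<Sum>k\<in>I. f k) = (\<Sum>k\<in>I. bil Y w (f k))"
  by (induction I rule: infinite_finite_induct) (auto simp: bil_add_left bil_add_right)

lemma bil_transpose: "bil (transpose Y) u w = bil Y w u"
proof -
  have "bil (transpose Y) u w = (\<Sum>i\<in>UNIV. \<Sum>j\<in>UNIV. u $ i * (Y $ j $ i * w $ j))"
    by (simp add: bil_def matrix_vector_mult_def transpose_def sum_distrib_left del: transpose_matrix_vector)
  also have "\<dots> = (\<Sum>j\<in>UNIV. \<Sum>i\<in>UNIV. u $ i * (Y $ j $ i * w $ j))"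
    by (rule sum.swap)
  also have "\<dots> = bil Y w u"
    by (simp add: bil_def matrix_vector_mult_def sum_distrib_left algebra_simps)
  finally show ?thesis .
qed

lemma bil_mult_right: "bil Y u (A *v w) = bil (Y ** A) u w"
  by (simp add: bil_def matrix_vector_mul_assoc)

lemma bil_mult_left: "bil Y (A *v u) w = bil (transpose A ** Y) u w"
proof -
  have "bil Y (A *v u) w = bil (transpose Y ** A) w u"
    by (simp add: bil_transpose[symmetric, of Y] bil_mult_right)
  also have "\<dots> = bil (transpose (transpose Y ** A)) u w"
    by (simp add: bil_transpose)
  finally show ?thesis
    by (simp add: matrix_transpose_mul)
qed

lemma bil_axis_left: "bil Y (axis i 1) w = (Y *v w) $ i"
  by (simp add: bil_def axis_def if_distrib[of "\<lambda>x. x * _"] cong: if_cong)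

lemma bil_eqI: "(\<And>u w. bil Y u w = bil Z u w) \<Longrightarrow> Y = Z"
  by (subst matrix_eq) (auto simp: vec_eq_iff bil_axis_left[symmetric])

lemma frame_bil_ext:
  assumes fr: "frame I v" and eq: "\<And>k l. k \<in> I \<Longrightarrow> l \<in> I \<Longrightarrow> bil Y (v k) (v l) = bil Z (v k) (v l)"
  shows "Y = Z"
proof (rule bil_eqI)
  let ?f = "frame_coord I v"
  fix u w
  have "bil Y (\<Sum>k\<in>I. ?f k u *s v k) (\<Sum>k\<in>I. ?f k w *s v k) =
    bil Z (\<Sum>k\<in>I. ?f k u *s v k) (\<Sum>k\<in>I. ?f k w *s v k)"
    by (simp add: bil_sum_left bil_sum_right bil_scale_left bil_scale_right eq)
  then show "bil Y u w = bil Z u w"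
    by (simp only: frame_expand[OF assms(1)])
qed

text \<open>If \<open>Q\<close> sends the frame to the standard basis and \<open>M\<close> is the
  desired Gram matrix there, the congruent matrix \<open>transpose Q ** M ** Q\<close> has the
  desired values on the frame.\<close>

lemma frame_bil_prescribe:
  fixes v :: "'i \<Rightarrow> complex^'n::finite"
  assumes fr: "frame I v"
  obtains Y where "\<And>k l. k \<in> I \<Longrightarrow> l \<in> I \<Longrightarrow> bil Y (v k) (v l) = h k l"
proof -
  obtain b where b: "bij_betw b (UNIV :: 'n set) I"
    using frame_bij[OF fr] .
  obtain Q where Q: "\<And>k. k \<in> I \<Longrightarrow> Q *v v k = axis (inv_into UNIV b k) 1"
    using frame_prescribe[OF fr, of "\<lambda>k. axis (inv_into UNIV b k) 1"] by metis
  define M where "M = (\<chi> i j. h (b i) (b j))"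
  have "bil (transpose Q ** M ** Q) (v k) (v l) = h k l" if "k \<in> I" "l \<in> I" for k l
  proof -
    have "bil (transpose Q ** M ** Q) (v k) (v l) = bil M (Q *v v k) (Q *v v l)"
      by (simp add: bil_mult_left bil_mult_right matrix_mul_assoc)
    also have "\<dots> = h (b (inv_into UNIV b k)) (b (inv_into UNIV b l))"
      by (simp add: Q that bil_axis_left mult_vec_axis M_def)
    finally show ?thesis
      using b that by (simp add: bij_betw_def f_inv_into_f)
  qed
  then show ?thesis
    by (rule that)
qed

lemma bil_nondegenerate_right:
  assumes "invertible B" "\<And>u. bil B u w = 0"
  shows "w = 0"
proof -
  have "B *v w = 0"
    using assms(2) by (simp add: vec_eq_iff bil_axis_left[symmetric])
  moreover obtain C where "C ** B = mat 1"
    using assms(1) by (auto simp: invertible_def)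
  ultimately show ?thesis
    by (metis matrix_vector_mul_assoc matrix_vector_mul_lid matrix_vector_mult_0_right)
qed

section \<open>Centralizers of cyclic matrices\<close>

lemma mscale_mult_left: "mscale c A ** B = mscale c (A ** B)"
  and mscale_mult_right: "A ** mscale c B = mscale c (A ** B)"
  and mscale_mult_vec: "mscale c A *v u = c *s (A *v u)"
  and transpose_mscale: "transpose (mscale c A) = mscale c (transpose A)"
  and transpose_add: "transpose (A + B) = transpose A + transpose B"
  and trace_mscale: "trace (mscale c A) = c * trace A"
  and mscale_uminus_one: "mscale (-1) A = - A"
  for A B :: "'n::finite cmat"
  by (auto simp: vec_eq_iff matrix_matrix_mult_def matrix_vector_mult_def transpose_def trace_def
      sum_distrib_left algebra_simps)

lemma matrix_add_rdistrib: "(A + B) ** C = A ** C + B ** (C :: 'n::finite cmat)"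
  and matrix_minus_left: "(- A) ** C = - (A ** (C :: 'n::finite cmat))"
  and matrix_minus_right: "C ** (- A) = - (C ** (A :: 'n::finite cmat))"
  by (auto simp: vec_eq_iff matrix_matrix_mult_def algebra_simps sum.distrib sum_subtractf sum_negf)

lemma sum_mult_vec: "(\<Sum>k\<in>I. f k) *v u = (\<Sum>k\<in>I. f k *v u :: complex^'n::finite)"
  by (induction I rule: infinite_finite_induct) (auto simp: matrix_vector_mult_add_rdistrib)

lemma sum_mult_mat: "(\<Sum>k\<in>I. f k) ** A = (\<Sum>k\<in>I. f k ** A)"
  and mult_mat_sum: "A ** (\<Sum>k\<in>I. f k) = (\<Sum>k\<in>I. A ** f k)"
  and transpose_sum: "transpose (\<Sum>k\<in>I. f k) = (\<Sum>k\<in>I. transpose (f k))"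
  for A :: "'n::finite cmat"
  by (induction I rule: infinite_finite_induct)
     (auto simp: matrix_add_rdistrib matrix_add_ldistrib transpose_add, auto simp: transpose_def vec_eq_iff)

text \<open>The matrices that are skew for the form \<open>B\<close>, shared by the
  \<open>SP\<close> and \<open>SO\<close> cases of \<open>lie_alg\<close>. It is also read with the
  matrix fixed and the form varying, as in \<open>invariant\<close>.\<close>

definition form_alg :: "'n::finite cmat \<Rightarrow> 'n cmat set" where
  "form_alg B = {X. transpose X ** B + B ** X = 0}"

lemma form_algD: "X \<in> form_alg B \<Longrightarrow> transpose X ** B = - (B ** X)"
  by (simp add: form_alg_def add_eq_0_iff2)

lemma form_algI: "transpose X ** B = - (B ** X) \<Longrightarrow> X \<in> form_alg B"
  by (simp add: form_alg_def)

lemma subspace_form_alg: "mat.subspace (form_alg B)"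
proof (rule mat.subspaceI)
  show "0 \<in> form_alg B"
    by (simp add: form_alg_def transpose_def vec_eq_iff matrix_matrix_mult_def)
next
  fix X Y c assume X: "X \<in> form_alg B"
  show "mscale c X \<in> form_alg B"
    by (rule form_algI)
       (simp add: transpose_mscale mscale_mult_left mscale_mult_right form_algD[OF X] vec_eq_iff)
  assume Y: "Y \<in> form_alg B"
  show "X + Y \<in> form_alg B"
    by (rule form_algI)
       (simp add: transpose_add matrix_add_rdistrib matrix_add_ldistrib form_algD[OF X] form_algD[OF Y])
qed

lemma subspace_trace_zero: "mat.subspace {X :: 'n::finite cmat. trace X = 0}"
  by (rule mat.subspaceI) (auto simp: trace_mscale trace_add trace_0[simplified])

lemma centralizer_iff: "X \<in> centralizer L S \<longleftrightarrow> X \<in> L \<and> (\<forall>Y\<in>S. X ** Y = Y ** X)"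
  by (simp add: centralizer_def bracket_def)

lemma subspace_centralizer:
  assumes "mat.subspace L"
  shows "mat.subspace (centralizer L S)"
  using assms
  by (intro mat.subspaceI)
     (auto simp: centralizer_iff mat.subspace_0 mat.subspace_add mat.subspace_scale
       matrix_add_rdistrib matrix_add_ldistrib mscale_mult_left mscale_mult_right)

text \<open>The identity centralizes everything and has nonzero trace, so the centralizer in
  \<open>gl(V)\<close> is the one in \<open>sl(V)\<close> plus the scalars.\<close>

lemma dim_centralizer_trace_zero:
  "mat.dim (centralizer UNIV S) = Suc (mat.dim (centralizer {X :: 'n::finite cmat. trace X = 0} S))"
    (is "mat.dim ?A = Suc (mat.dim ?B)")
proof -
  have subB: "mat.subspace ?B"
    by (intro subspace_centralizer subspace_trace_zero)
  have subA: "mat.subspace ?A"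
    by (intro subspace_centralizer mat.subspace_UNIV)
  have tr: "trace (mat 1 :: 'n cmat) \<noteq> 0"
    by (simp add: trace_I)
  have 1: "mat 1 \<in> ?A"
    by (simp add: centralizer_iff)
  have "mat 1 \<notin> mat.span ?B"
    using tr subB by (simp add: mat.span_eq_iff[THEN iffD2] centralizer_iff)
  then have "mat.dim (insert (mat 1) ?B) = Suc (mat.dim ?B)"
    by (simp add: mat.dim_insert)
  moreover have "mat.span (insert (mat 1) ?B) = ?A"
  proof
    show "mat.span (insert (mat 1) ?B) \<subseteq> ?A"
      using 1 by (intro mat.span_minimal subA) (auto simp: centralizer_iff)
    show "?A \<subseteq> mat.span (insert (mat 1) ?B)"
    proof
      fix X assume X: "X \<in> ?A"
      define c where "c = trace X / trace (mat 1 :: 'n cmat)"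
      have "X - mscale c (mat 1) \<in> ?B"
        using mat.subspace_diff[OF subA X mat.subspace_scale[OF subA 1, of c]] tr
        by (simp add: centralizer_iff trace_sub trace_mscale c_def)
      then have "(X - mscale c (mat 1)) + mscale c (mat 1) \<in> mat.span (insert (mat 1) ?B)"
        by (intro mat.span_add mat.span_scale) (auto intro: mat.span_base)
      then show "X \<in> mat.span (insert (mat 1) ?B)"
        by simp
    qed
  qed
  ultimately show ?thesis
    by (metis mat.dim_span)
qed

section \<open>Matrix powers and cyclic vectors\<close>

definition mpow :: "'n::finite cmat \<Rightarrow> nat \<Rightarrow> 'n cmat" where
  "mpow x k = (((**) x) ^^ k) (mat 1)"

lemma mpow_0 [simp]: "mpow x 0 = mat 1"
  and mpow_Suc: "mpow x (Suc k) = x ** mpow x k"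
  by (simp_all add: mpow_def)

lemma mpow_commute: "Z ** x = x ** Z \<Longrightarrow> Z ** mpow x k = mpow x k ** Z"
  by (induction k) (simp_all add: mpow_Suc matrix_mul_assoc, metis matrix_mul_assoc)

lemma mpow_Suc2: "mpow x (Suc k) = mpow x k ** x"
  using mpow_commute[of x x k] by (simp add: mpow_Suc)

lemma mpow_add: "mpow x (j + k) = mpow x j ** mpow x k"
  by (induction j) (simp_all add: mpow_Suc matrix_mul_assoc)

text \<open>Each factor \<open>x\<close> changes the sign when it passes \<open>B\<close>. Odd
  powers of \<open>x\<close> are therefore skew for \<open>B\<close>, and even powers
  self-adjoint.\<close>

lemma form_alg_mpow:
  assumes "x \<in> form_alg B"
  shows "transpose (mpow x k) ** B = mscale ((-1) ^ k) (B ** mpow x k)"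
proof (induction k)
  case (Suc k)
  have "transpose (mpow x (Suc k)) ** B = transpose (mpow x k) ** (transpose x ** B)"
    by (simp add: mpow_Suc matrix_transpose_mul matrix_mul_assoc)
  also have "\<dots> = - (transpose (mpow x k) ** B ** x)"
    by (simp add: form_algD[OF assms] matrix_minus_right matrix_mul_assoc)
  also have "\<dots> = - mscale ((-1) ^ k) (B ** mpow x (Suc k))"
    by (simp add: Suc mscale_mult_left mpow_Suc2 matrix_mul_assoc)
  finally show ?case
    by (simp add: vec_eq_iff)
qed (simp add: vec_eq_iff)

definition cyclic :: "'n::finite cmat \<Rightarrow> complex^'n \<Rightarrow> bool" where
  "cyclic x v \<longleftrightarrow> frame {..<CARD('n)} (\<lambda>k. mpow x k *v v)"

text \<open>If \<open>v\<close> is cyclic for \<open>x\<close> and \<open>Z\<close> commutes with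
  \<open>x\<close>, this is the coefficient of \<open>mpow x k\<close> in \<open>Z\<close>, read off
  from the single vector \<open>Z *v v\<close>.\<close>

definition power_coord :: "'n::finite cmat \<Rightarrow> complex^'n \<Rightarrow> nat \<Rightarrow> 'n cmat \<Rightarrow> complex" where
  "power_coord x v k Z = frame_coord {..<CARD('n)} (\<lambda>k. mpow x k *v v) k (Z *v v)"

lemma power_coord_add: "power_coord x v k (Y + Z) = power_coord x v k Y + power_coord x v k Z"
  and power_coord_scale: "power_coord x v k (mscale c Z) = c * power_coord x v k Z"
  by (simp_all add: power_coord_def matrix_vector_mult_add_rdistrib mscale_mult_vec
      frame_coord_add frame_coord_scale)

lemma power_coord_mpow:
  fixes x :: "'n::finite cmat"
  assumes "cyclic x v" "k < CARD('n)" "l < CARD('n)"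
  shows "power_coord x v k (mpow x l) = (if k = l then 1 else 0)"
  using frame_coord_dual[OF assms(1)[unfolded cyclic_def], of k l] assms(2,3)
  by (simp add: power_coord_def)

text \<open>The polynomial \<open>?S\<close> in \<open>x\<close> agrees with \<open>Z\<close> on
  \<open>v\<close>. Both commute with \<open>x\<close>, so they agree on every
  \<open>mpow x l *v v\<close>, and these vectors form a frame.\<close>

lemma cyclic_centralizer_expand:
  fixes x :: "'n::finite cmat"
  assumes cyc: "cyclic x v" and Z: "Z ** x = x ** Z"
  shows "Z = (\<Sum>k<CARD('n). mscale (power_coord x v k Z) (mpow x k))" (is "_ = ?S")
proof (rule frame_ext[OF cyc[unfolded cyclic_def]])
  fix l
  have xS: "?S ** mpow x l = mpow x l ** ?S"
    by (simp add: sum_mult_mat mult_mat_sum mscale_mult_left mscale_mult_right mpow_add[symmetric]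
        add.commute)
  have "?S *v v = Z *v v"
    using frame_expand[OF cyc[unfolded cyclic_def], of "Z *v v"]
    by (simp add: sum_mult_vec mscale_mult_vec power_coord_def)
  then have "mpow x l *v (Z *v v) = mpow x l *v (?S *v v)"
    by simp
  then show "Z *v (mpow x l *v v) = ?S *v (mpow x l *v v)"
    by (simp only: matrix_vector_mul_assoc mpow_commute[OF Z] xS)
qed

lemma dim_centralizer_cyclic:
  fixes x :: "'n::finite cmat"
  assumes "cyclic x v"
  shows "mat.dim (centralizer UNIV {x}) = CARD('n)"
proof -
  have "mat.dim (centralizer UNIV {x}) = card {..<CARD('n)}"
  proof (rule mat.dim_eq_card_dual_functionals(2)[where f = "power_coord x v" and b = "mpow x"])
    show "mpow x k \<in> centralizer UNIV {x}" for k
      by (simp add: centralizer_iff mpow_commute[of x x])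
    show "Z = 0" if "Z \<in> centralizer UNIV {x}" "\<And>k. k \<in> {..<CARD('n)} \<Longrightarrow> power_coord x v k Z = 0" for Z
      using cyclic_centralizer_expand[OF assms, of Z] that by (simp add: centralizer_iff)
  qed (simp_all add: subspace_centralizer power_coord_add power_coord_scale power_coord_mpow[OF assms])
  then show ?thesis by simp
qed

lemma card_odd_less: "card {k. k < n \<and> odd k} = n div 2"
proof (induction n)
  case (Suc n)
  have "{k. k < Suc n \<and> odd k} = (if odd n then insert n else id) {k. k < n \<and> odd k}"
    by (auto simp: less_Suc_eq)
  then show ?case
    using Suc by auto
qed simp

text \<open>The odd powers of \<open>x\<close> form a basis. If all odd coefficients of a
  centralizing \<open>Z\<close> vanish, then \<open>Z\<close> is self-adjoint as well as skew, and
  nondegeneracy of \<open>B\<close> gives \<open>Z = 0\<close>.\<close>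

lemma dim_centralizer_cyclic_form:
  fixes x :: "'n::finite cmat"
  assumes cyc: "cyclic x v" and B: "invertible B" and x: "x \<in> form_alg B"
  shows "mat.dim (centralizer (form_alg B) {x}) = CARD('n) div 2"
proof -
  have "mat.dim (centralizer (form_alg B) {x}) = card {k. k < CARD('n) \<and> odd k}"
  proof (rule mat.dim_eq_card_dual_functionals(2)[where f = "power_coord x v" and b = "mpow x"])
    show "mpow x k \<in> centralizer (form_alg B) {x}" if "k \<in> {k. k < CARD('n) \<and> odd k}" for k
      using form_alg_mpow[OF x, of k] that
      by (auto simp: centralizer_iff mpow_commute[of x x] mscale_uminus_one intro!: form_algI)
    show "Z = 0" if Z: "Z \<in> centralizer (form_alg B) {x}"
      and 0: "\<And>k. k \<in> {k. k < CARD('n) \<and> odd k} \<Longrightarrow> power_coord x v k Z = 0" for Z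
    proof -
      let ?S = "\<Sum>k<CARD('n). mscale (power_coord x v k Z) (mpow x k)"
      have ZS: "Z = ?S"
        using cyclic_centralizer_expand[OF cyc] Z by (simp add: centralizer_iff)
      \<comment> \<open>Odd terms have zero coefficient, and even powers pass \<open>B\<close>
        without a sign.\<close>
      have "mscale (power_coord x v k Z) (transpose (mpow x k) ** B) =
          mscale (power_coord x v k Z) (B ** mpow x k)" if "k < CARD('n)" for k
        using 0[of k] that by (cases "odd k") (auto simp: form_alg_mpow[OF x])
      then have "transpose ?S ** B = B ** ?S"
        unfolding transpose_sum sum_mult_mat mult_mat_sum transpose_mscale mscale_mult_left
          mscale_mult_right by (intro sum.cong) auto
      then have "transpose Z ** B = B ** Z"
        by (simp only: ZS[symmetric])
      moreover have "transpose Z ** B = - (B ** Z)"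
        using Z by (auto simp: centralizer_iff dest: form_algD)
      ultimately have "B ** Z = - (B ** Z)"
        by simp
      then have "B ** Z = 0"
        by (simp add: vec_eq_iff equal_neg_zero)
      then have "matrix_inv B ** (B ** Z) = 0"
        by simp
      then show "Z = 0"
        by (simp add: matrix_mul_assoc matrix_inv_inverse[OF B])
    qed
  qed (simp_all add: subspace_centralizer subspace_form_alg power_coord_add power_coord_scale
      power_coord_mpow[OF cyc])
  then show ?thesis
    by (simp add: card_odd_less)
qed

section \<open>Semicontinuity and the rank\<close>

text \<open>A basis of \<open>S\<close> is extended to one of \<open>L\<close>, and \<open>C\<close>
  is the span of the added vectors. The trivial intersection follows from the dimension formula for
  sums.\<close>

lemma (in finite_dimensional_vector_space) subspace_complement:
  assumes "subspace S" "subspace L" "S \<subseteq> L"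
  obtains C where "subspace C" "C \<subseteq> L" "S \<inter> C \<subseteq> {0}" "dim S + dim C = dim L"
proof -
  obtain A where A: "A \<subseteq> S" "independent A" "S \<subseteq> span A" "card A = dim S"
    using basis_exists by blast
  obtain A' where A': "A \<subseteq> A'" "A' \<subseteq> L" "independent A'" "L \<subseteq> span A'"
    using maximal_independent_subset_extend[of A L] A assms by blast
  have fin: "finite A'"
    using A'(3) by (rule finiteI_independent)
  define C where "C = span (A' - A)"
  have "dim C = card (A' - A)"
    unfolding C_def
    by (metis A'(3) Diff_subset dim_span dim_eq_card_independent independent_mono)
  moreover have "dim L = card A'"
    using A' by (metis dim_unique)
  moreover have "card A' = card A + card (A' - A)"
    using A'(1) fin by (metis card_Diff_subset card_mono finite_subset le_add_diff_inverse)
  ultimately have dims: "dim S + dim C = dim L"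
    using A(4) by simp
  have sub: "subspace C"
    by (simp add: C_def)
  let ?ST = "{x + y |x y. x \<in> S \<and> y \<in> C}"
  have "A' \<subseteq> ?ST"
  proof
    fix a assume "a \<in> A'"
    then have "a \<in> S \<or> a \<in> C"
      using A(1) by (auto simp: C_def intro: span_base)
    then show "a \<in> ?ST"
    proof
      assume "a \<in> S"
      then show ?thesis
        using subspace_0[OF sub] by (intro CollectI exI[of _ a] exI[of _ 0]) simp
    next
      assume "a \<in> C"
      then show ?thesis
        using subspace_0[OF assms(1)] by (intro CollectI exI[of _ 0] exI[of _ a]) simp
    qed
  qed
  then have "dim L \<le> dim ?ST"
    using \<open>dim L = card A'\<close> A'(3) by (simp add: independent_card_le_dim)
  then have "dim (S \<inter> C) = 0"
    using dim_sums_Int[OF assms(1) sub] dims by linarith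
  then have "S \<inter> C \<subseteq> {0}"
    by simp
  moreover have "C \<subseteq> L"
    unfolding C_def using A'(2) by (intro span_minimal assms) auto
  ultimately show ?thesis
    using that[of C] sub dims by blast
qed

lemma (in finite_dimensional_vector_space) dim_disjoint_subspaces_le:
  assumes "subspace S" "subspace C" "subspace L" "S \<subseteq> L" "C \<subseteq> L" "S \<inter> C \<subseteq> {0}"
  shows "dim S + dim C \<le> dim L"
proof -
  let ?ST = "{x + y |x y. x \<in> S \<and> y \<in> C}"
  have "?ST \<subseteq> L"
    using assms by (auto intro: subspace_add)
  moreover have "dim (S \<inter> C) = 0"
    using assms(6) by simp
  ultimately show ?thesis
    using dim_sums_Int[OF assms(1,2)] dim_subset[of ?ST L] by linarith
qed

lemma norm_mscale: "norm (mscale t A) = cmod t * norm A"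
  by (simp add: mscale_def norm_vec_def norm_mult L2_set_right_distrib)

lemma scaleR_eq_mscale: "r *\<^sub>R A = mscale (of_real r) A"
  by (simp add: vec_eq_iff complex_eq_iff)

lemma bounded_linear_bracket: "bounded_linear (\<lambda>c. bracket c z)"
proof -
  have "linear (\<lambda>c. bracket c z)"
    by (rule linearI)
       (simp_all add: bracket_def matrix_add_rdistrib matrix_add_ldistrib scaleR_eq_mscale
         mscale_mult_left mscale_mult_right mat.scale_right_diff_distrib)
  then show ?thesis
    by (simp add: linear_conv_bounded_linear)
qed

text \<open>On a complement \<open>C\<close> of the centralizer of \<open>x\<close>, bracketing with
  \<open>x\<close> is injective, hence bounded below. A small perturbation keeps it injective there,
  so the perturbed centralizer meets \<open>C\<close> trivially and cannot be larger than the
  original one.\<close>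

lemma dim_centralizer_upper_semicontinuous:
  fixes x z :: "'n::finite cmat"
  assumes L: "mat.subspace L"
  obtains d where "d > 0"
    "\<And>t. cmod t < d \<Longrightarrow> mat.dim (centralizer L {x + mscale t z}) \<le> mat.dim (centralizer L {x})"
proof -
  let ?S = "centralizer L {x}"
  have "?S \<subseteq> L"
    by (auto simp: centralizer_iff)
  then obtain C where C: "mat.subspace C" "C \<subseteq> L" "?S \<inter> C \<subseteq> {0}"
    "mat.dim ?S + mat.dim C = mat.dim L"
    using mat.subspace_complement[OF subspace_centralizer[OF L] L] by blast
  \<comment> \<open>The lower bound below comes from real normed spaces, so \<open>C\<close> is
    regarded as a real subspace.\<close>
  have "subspace C"
    using C(1) by (auto simp: subspace_def mat.subspace_def scaleR_eq_mscale)
  moreover have "\<forall>c\<in>C. bracket c x = 0 \<longrightarrow> c = 0"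
    using C(2,3) by (auto simp: centralizer_def)
  ultimately obtain e where e: "e > 0" "\<forall>c\<in>C. norm (bracket c x) \<ge> e * norm c"
    using injective_imp_isometric[OF closed_subspace _ bounded_linear_bracket] by blast
  obtain K where K: "K > 0" "\<And>c. norm (bracket c z) \<le> norm c * K"
    using bounded_linear.pos_bounded[OF bounded_linear_bracket[of z]] by blast
  show ?thesis
  proof (rule that[of "e / K"])
    show "e / K > 0"
      using e K by simp
    fix t assume t: "cmod t < e / K"
    let ?Z = "centralizer L {x + mscale t z}"
    have "?Z \<inter> C \<subseteq> {0}"
    proof safe
      fix c assume c: "c \<in> ?Z" "c \<in> C"
      have "bracket c (x + mscale t z) = bracket c x + mscale t (bracket c z)"
        by (simp add: bracket_def matrix_add_rdistrib matrix_add_ldistrib mscale_mult_left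
            mscale_mult_right mat.scale_right_diff_distrib)
      then have "bracket c x = - mscale t (bracket c z)"
        using c by (simp add: centralizer_def add_eq_0_iff2)
      then have "norm (bracket c x) \<le> cmod t * (norm c * K)"
        using K(2)[of c] by (simp add: norm_mscale mult_left_mono)
      then have "e * norm c \<le> cmod t * K * norm c"
        using e(2) c(2) by (force simp: mult_ac)
      moreover have "cmod t * K < e"
        using t K(1) by (simp add: field_simps)
      ultimately have "norm c \<le> 0"
        by (metis mult_le_cancel_right not_less)
      then show "c = 0" by simp
    qed
    then have "mat.dim ?Z + mat.dim C \<le> mat.dim L"
      by (intro mat.dim_disjoint_subspaces_le subspace_centralizer L C)
         (auto simp: centralizer_iff)
    then show "mat.dim ?Z \<le> mat.dim ?S"
      using C(4) by linarith
  qed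
qed

section \<open>Cyclicity is generic along a line\<close>

definition poly_fun :: "(complex \<Rightarrow> complex) \<Rightarrow> bool" where
  "poly_fun f \<longleftrightarrow> (\<exists>p. f = poly p)"

lemma poly_fun_const: "poly_fun (\<lambda>t. c)"
  unfolding poly_fun_def by (intro exI[of _ "[:c:]"]) auto

lemma poly_fun_id: "poly_fun (\<lambda>t. t)"
  unfolding poly_fun_def by (intro exI[of _ "[:0, 1:]"]) auto

lemma poly_fun_add: "poly_fun f \<Longrightarrow> poly_fun g \<Longrightarrow> poly_fun (\<lambda>t. f t + g t)"
  unfolding poly_fun_def fun_eq_iff by (metis poly_add)

lemma poly_fun_mult: "poly_fun f \<Longrightarrow> poly_fun g \<Longrightarrow> poly_fun (\<lambda>t. f t * g t)"
  unfolding poly_fun_def fun_eq_iff by (metis poly_mult)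

lemma poly_fun_sum: "(\<And>i. i \<in> I \<Longrightarrow> poly_fun (f i)) \<Longrightarrow> poly_fun (\<lambda>t. \<Sum>i\<in>I. f i t)"
  by (induction I rule: infinite_finite_induct) (auto intro: poly_fun_const poly_fun_add)

lemma poly_fun_prod: "(\<And>i. i \<in> I \<Longrightarrow> poly_fun (f i)) \<Longrightarrow> poly_fun (\<lambda>t. \<Prod>i\<in>I. f i t)"
  by (induction I rule: infinite_finite_induct) (auto intro: poly_fun_const poly_fun_mult)

lemma poly_fun_mpow_line: "poly_fun (\<lambda>t. mpow (x + mscale t z) k $ i $ j)"
proof (induction k arbitrary: i j)
  case (Suc k)
  then show ?case
    by (auto simp: mpow_Suc matrix_matrix_mult_def
        intro!: poly_fun_sum poly_fun_mult poly_fun_add poly_fun_const poly_fun_id)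
qed (simp add: poly_fun_const)

text \<open>The determinant of the vectors \<open>mpow (x + mscale t (y - x)) k *v v\<close> is a
  polynomial in \<open>t\<close>. It is nonzero at \<open>t = 1\<close>, where the line passes
  through \<open>y\<close>, so it has finitely many roots.\<close>

lemma cyclic_line:
  fixes x y :: "'n::finite cmat"
  assumes y: "cyclic y v"
  shows "finite {t. \<not> cyclic (x + mscale t (y - x)) v}"
proof -
  obtain b where b: "bij_betw b (UNIV :: 'n set) {..<CARD('n)}"
    using frame_bij[OF y[unfolded cyclic_def]] .
  define q where "q t = det (\<chi> i j. (mpow (x + mscale t (y - x)) (b j) *v v) $ i)" for t
  have cyc: "cyclic (x + mscale t (y - x)) v \<longleftrightarrow> q t \<noteq> 0" for t
    unfolding cyclic_def invertible_frame_matrix[OF b] q_def by (simp add: invertible_det_nz)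
  have "poly_fun q"
    unfolding q_def det_def
    by (intro poly_fun_sum poly_fun_mult poly_fun_const poly_fun_prod)
       (auto simp: matrix_vector_mult_def intro!: poly_fun_sum poly_fun_mult poly_fun_const poly_fun_mpow_line)
  then obtain p where p: "q = poly p"
    by (auto simp: poly_fun_def)
  have "q 1 \<noteq> 0"
    using y cyc[of 1] by simp
  then have "p \<noteq> 0"
    using p by auto
  then show ?thesis
    using poly_roots_finite[of p] by (simp add: cyc p)
qed

text \<open>On the line from any \<open>x\<close> towards \<open>y\<close> there are elements
  arbitrarily near \<open>x\<close> for which \<open>v\<close> is cyclic. Their centralizers have
  dimension \<open>r\<close>, which by semicontinuity is at most that of the centralizer of
  \<open>x\<close>; \<open>y\<close> attains the value.\<close>

lemma lie_rank_eq:
  fixes L :: "'n::finite cmat set"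
  assumes L: "mat.subspace L" and y: "y \<in> L" "cyclic y v"
    and r: "\<And>x. x \<in> L \<Longrightarrow> cyclic x v \<Longrightarrow> mat.dim (centralizer L {x}) = r"
  shows "lie_rank L = r"
proof -
  have "r \<le> mat.dim (centralizer L {x})" if x: "x \<in> L" for x
  proof -
    obtain d where d: "d > 0" "\<And>t. cmod t < d \<Longrightarrow>
        mat.dim (centralizer L {x + mscale t (y - x)}) \<le> mat.dim (centralizer L {x})"
      using dim_centralizer_upper_semicontinuous[OF L, of x "y - x"] by blast
    \<comment> \<open>An infinite ball cannot consist of the finitely many exceptional
      parameters.\<close>
    have "infinite (UNIV \<inter> ball (0 :: complex) d)"
      using islimpt_UNIV[of "0 :: complex"] d(1) unfolding islimpt_eq_infinite_ball by blast
    then have "\<not> UNIV \<inter> ball 0 d \<subseteq> {t. \<not> cyclic (x + mscale t (y - x)) v}"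
      using cyclic_line[OF y(2), of x] finite_subset by blast
    then obtain t where t: "t \<in> ball 0 d" "cyclic (x + mscale t (y - x)) v"
      by blast
    have "x + mscale t (y - x) \<in> L"
      using x y(1) by (intro mat.subspace_add mat.subspace_scale mat.subspace_diff L)
    then show ?thesis
      using r t d(2)[of t] by (simp add: dist_norm)
  qed
  moreover have "mat.dim (centralizer L {y}) = r"
    by (rule r[OF y])
  moreover have "finite ((\<lambda>x. cdim (centralizer L {x})) ` L)"
    by (rule finite_subset[of _ "{..mat.dim (UNIV :: 'n cmat set)}"])
       (auto simp: cdim_eq simp del: mat.dim_UNIV intro: mat.dim_subset)
  ultimately show ?thesis
    unfolding lie_rank_def using y(1) by (intro Min_eqI) (auto simp: cdim_eq)
qed

section \<open>Cyclic elements of the classical Lie algebras\<close>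

lemma mpow_eigenvector: "y *v e = a *s e \<Longrightarrow> mpow y k *v e = a ^ k *s e"
  by (induction k)
     (simp_all add: mpow_Suc matrix_vector_mul_assoc[symmetric] vector_scalar_commute
       vector_smult_assoc mult.commute)

text \<open>The Vandermonde argument: a vanishing combination of the powers applied to the sum of
  all eigenvectors gives a polynomial of degree below \<open>CARD('n)\<close> that vanishes at all
  \<open>CARD('n)\<close> eigenvalues.\<close>

lemma cyclic_distinct_eigenvalues:
  fixes y :: "'n::finite cmat"
  assumes fr: "frame I e" and eig: "\<And>j. j \<in> I \<Longrightarrow> y *v e j = a j *s e j" and inj: "inj_on a I"
  shows "cyclic y (\<Sum>j\<in>I. e j)"
  unfolding cyclic_def frame_def
proof (intro conjI allI impI)
  have I: "finite I" "card I = CARD('n)"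
    using fr by (auto simp: frame_def)
  fix c assume c: "(\<Sum>k<CARD('n). c k *s (mpow y k *v (\<Sum>j\<in>I. e j))) = 0"
  define p where "p = (\<Sum>k<CARD('n). monom (c k) k)"
  have "(\<Sum>k<CARD('n). c k *s (mpow y k *v (\<Sum>j\<in>I. e j))) =
      (\<Sum>k<CARD('n). \<Sum>j\<in>I. (c k * a j ^ k) *s e j)"
    by (intro sum.cong refl)
       (simp add: mult_vec_sum mpow_eigenvector[OF eig] vec.scale_sum_right vector_smult_assoc)
  also have "\<dots> = (\<Sum>j\<in>I. poly p (a j) *s e j)"
    by (subst sum.swap) (simp add: p_def poly_sum poly_monom vec.scale_sum_left)
  finally have "\<forall>j\<in>I. poly p (a j) = 0"
    using fr[unfolded frame_def, THEN conjunct2, THEN conjunct2, THEN spec, of "\<lambda>j. poly p (a j)"] c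
    by simp
  then have roots: "a ` I \<subseteq> {x. poly p x = 0}"
    by auto
  have "p = 0"
  proof (rule ccontr)
    assume p: "p \<noteq> 0"
    have "CARD('n) \<le> card {x. poly p x = 0}"
      using card_mono[OF poly_roots_finite[OF p] roots] by (simp add: card_image[OF inj] I)
    also have "\<dots> \<le> degree p"
      by (rule card_poly_roots_bound[OF p])
    also have "degree p \<le> CARD('n) - 1"
      unfolding p_def by (intro degree_sum_le) (auto intro: order_trans[OF degree_monom_le])
    finally show False
      by (metis One_nat_def Suc_pred le_imp_less_Suc less_irrefl zero_less_card_finite)
  qed
  moreover have "coeff p k = c k" if "k < CARD('n)" for k
    using that by (simp add: p_def coeff_sum)
  ultimately show "\<forall>k\<in>{..<CARD('n)}. c k = 0"
    by (metis coeff_0 lessThan_iff)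
qed simp_all

text \<open>A diagonal matrix with distinct entries, shifted by their mean to make the trace
  zero.\<close>

lemma ex_cyclic_trace_zero: "\<exists>y v. trace (y :: 'n::finite cmat) = 0 \<and> cyclic y v"
proof -
  obtain b :: "'n \<Rightarrow> nat" where b: "inj b"
    using finite_imp_inj_to_nat_seg[of "UNIV :: 'n set"] by auto
  define m where "m = (\<Sum>j\<in>(UNIV :: 'n set). of_nat (b j)) / (of_nat CARD('n) :: complex)"
  define a where "a j = of_nat (b j) - m" for j
  define y where "y = (\<chi> i j. if i = j then a i else 0)"
  have "trace y = 0"
    by (simp add: trace_def y_def a_def sum_subtractf m_def)
  moreover have "y *v axis j 1 = a j *s axis j 1" for j
    unfolding mult_vec_axis by (auto simp: y_def vec_eq_iff axis_def)
  then have "cyclic y (\<Sum>j\<in>UNIV. axis j 1)"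
    using b by (intro cyclic_distinct_eigenvalues[OF frame_axis, of _ a]) (auto simp: a_def inj_def)
  ultimately show ?thesis by blast
qed

text \<open>Fewer linear equations than unknowns have a nonzero common solution.\<close>

lemma ex_common_kernel:
  fixes f :: "nat \<Rightarrow> complex^'n::finite"
  assumes "m < CARD('n)"
  obtains x where "x \<noteq> 0" "\<And>i. i < m \<Longrightarrow> (\<Sum>r\<in>UNIV. f i $ r * x $ r) = 0"
proof -
  obtain b where b: "bij_betw b (UNIV :: 'n set) {..<CARD('n)}"
    using finite_same_card_bij[of "UNIV :: 'n set" "{..<CARD('n)}"] by auto
  \<comment> \<open>The system is padded with zero rows to a square matrix, whose determinant then
    vanishes.\<close>
  define A where "A = (\<chi> j. if b j < m then f (b j) else 0)"
  have bij: "\<exists>j. b j = i" if "i < CARD('n)" for i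
    using b that by (metis bij_betw_imp_surj_on imageE lessThan_iff)
  obtain j0 where "b j0 = m"
    using bij[OF assms] by blast
  then have "row j0 A = 0"
    by (simp add: row_def A_def vec_eq_iff)
  then have "det A = 0"
    by (rule det_zero_row)
  then have "\<not> (\<exists>C. C ** A = mat 1)"
    by (metis invertible_det_nz invertible_left_inverse)
  then obtain x where x: "A *v x = 0" "x \<noteq> 0"
    unfolding matrix_left_invertible_ker by blast
  show ?thesis
  proof (rule that[OF x(2)])
    fix i assume i: "i < m"
    then obtain j where j: "b j = i"
      using bij assms by (meson less_trans)
    have "(A *v x) $ j = 0"
      using x by simp
    then show "(\<Sum>r\<in>UNIV. f i $ r * x $ r) = 0"
      using i j by (simp add: matrix_vector_mult_def A_def)
  qed
qed

section \<open>Isotropic vectors and hyperbolic bases\<close>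

lemma bil_eq_sum: "bil B u x = (\<Sum>r\<in>UNIV. (transpose B *v u) $ r * x $ r)"
  using bil_transpose[of "transpose B" u x] by (simp add: bil_def mult.commute)

text \<open>A family of \<open>k\<close> mutually orthogonal hyperbolic planes. The pairing of
  \<open>w i\<close> with \<open>u j\<close> is not recorded, since it follows from the symmetry of
  the form.\<close>

definition hyperbolic :: "'n::finite cmat \<Rightarrow> nat \<Rightarrow> (nat \<Rightarrow> complex^'n) \<Rightarrow> (nat \<Rightarrow> complex^'n) \<Rightarrow> bool" where
  "hyperbolic B k u w \<longleftrightarrow> (\<forall>i<k. \<forall>j<k. bil B (u i) (u j) = 0 \<and> bil B (w i) (w j) = 0 \<and>
     bil B (u i) (w j) = (if i = j then 1 else 0))"

definition perp :: "'n::finite cmat \<Rightarrow> nat \<Rightarrow> (nat \<Rightarrow> complex^'n) \<Rightarrow> (nat \<Rightarrow> complex^'n) \<Rightarrow> (complex^'n) set" where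
  "perp B k u w = {x. \<forall>i<k. bil B (u i) x = 0 \<and> bil B (w i) x = 0}"

lemma ex_perp:
  fixes B :: "'n::finite cmat"
  assumes "2 * k < CARD('n)"
  obtains x where "x \<noteq> 0" "x \<in> perp B k u w"
proof -
  obtain x where x: "x \<noteq> 0" "\<And>i. i < 2 * k \<Longrightarrow>
      (\<Sum>r\<in>UNIV. (transpose B *v (if i < k then u i else w (i - k))) $ r * x $ r) = 0"
    using ex_common_kernel[OF assms, of "\<lambda>i. transpose B *v (if i < k then u i else w (i - k))"]
    by metis
  have "bil B (u i) x = 0 \<and> bil B (w i) x = 0" if "i < k" for i
    using x(2)[of i] x(2)[of "i + k"] that by (simp add: bil_eq_sum)
  then show ?thesis
    using that[OF x(1)] by (simp add: perp_def)
qed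

text \<open>The extra equation on the coordinate \<open>c\<close> makes the solution independent of
  any vector whose coordinate \<open>c\<close> is nonzero.\<close>

lemma ex_perp_coord_zero:
  fixes B :: "'n::finite cmat"
  assumes "Suc (2 * k) < CARD('n)"
  obtains x where "x \<noteq> 0" "x \<in> perp B k u w" "x $ c = 0"
proof -
  define f where "f i = (if i < k then transpose B *v u i else if i < 2 * k then transpose B *v w (i - k)
    else axis c 1)" for i
  obtain x where x: "x \<noteq> 0" "\<And>i. i < Suc (2 * k) \<Longrightarrow> (\<Sum>r\<in>UNIV. f i $ r * x $ r) = 0"
    using ex_common_kernel[OF assms, of f] by metis
  have "bil B (u i) x = 0 \<and> bil B (w i) x = 0" if "i < k" for i
    using x(2)[of i] x(2)[of "i + k"] that by (simp add: bil_eq_sum f_def)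
  moreover have "x $ c = 0"
    using x(2)[of "2 * k"] by (simp add: f_def axis_def if_distrib[of "\<lambda>x. x * _"] cong: if_cong)
  ultimately show ?thesis
    using that[OF x(1)] by (simp add: perp_def)
qed

context
  fixes B :: "'n::finite cmat" and s :: complex
  assumes B: "invertible B" and sym: "\<And>u w. bil B u w = s * bil B w u" and s: "s = 1 \<or> s = -1"
begin

text \<open>The sign \<open>s\<close> covers symmetric and skew forms at once. There are two
  independent vectors \<open>x\<close> and \<open>z\<close> in the orthogonal space; either
  \<open>z\<close> is isotropic, or some \<open>x + t *s z\<close> is, because a quadratic equation
  over the complex numbers has a root.\<close>

lemma ex_isotropic_perp:
  assumes "Suc (2 * k) < CARD('n)"
  obtains x where "x \<noteq> 0" "x \<in> perp B k u w" "bil B x x = 0"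
proof -
  obtain x where x: "x \<noteq> 0" "x \<in> perp B k u w"
    using ex_perp[of k] assms by (metis Suc_lessD)
  obtain c where c: "x $ c \<noteq> 0"
    using x(1) by (auto simp: vec_eq_iff)
  obtain z where z: "z \<noteq> 0" "z \<in> perp B k u w" "z $ c = 0"
    using ex_perp_coord_zero[OF assms] by metis
  show ?thesis
  proof (cases "bil B z z = 0")
    case True
    then show ?thesis
      using that z by blast
  next
    case False
    \<comment> \<open>For a skew form every vector is isotropic.\<close>
    then have "s = 1"
      using sym[of z z] s by auto
    define q where "q = bil B x z"
    \<comment> \<open>\<open>D\<close> is the root of the reduced discriminant, and \<open>t\<close>
      a solution of the quadratic equation
      \<open>bil B (x + t *s z) (x + t *s z) = 0\<close>.\<close>
    define D where "D = csqrt (q\<^sup>2 - bil B x x * bil B z z)"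
    define t where "t = (D - q) / bil B z z"
    have "bil B z x = q"
      using sym[of z x] \<open>s = 1\<close> by (simp add: q_def)
    then have "bil B (x + t *s z) (x + t *s z) = bil B x x + 2 * t * q + t\<^sup>2 * bil B z z"
      by (simp add: bil_add_left bil_add_right bil_scale_left bil_scale_right q_def power2_eq_square
          algebra_simps)
    also have "\<dots> = (bil B x x * bil B z z + 2 * q * (D - q) + (D - q)\<^sup>2) / bil B z z"
      using False by (simp add: t_def field_simps power2_eq_square)
    also have "bil B x x * bil B z z + 2 * q * (D - q) + (D - q)\<^sup>2 = bil B x x * bil B z z - q\<^sup>2 + D\<^sup>2"
      by (simp add: power2_eq_square algebra_simps)
    also have "\<dots> = 0"
      by (simp add: D_def)
    finally have "bil B (x + t *s z) (x + t *s z) = 0"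
      by simp
    moreover have "x + t *s z \<in> perp B k u w"
      using x z by (simp add: perp_def bil_add_right bil_scale_right)
    moreover have "(x + t *s z) $ c \<noteq> 0"
      using c z(3) by simp
    then have "x + t *s z \<noteq> 0"
      by (metis zero_index)
    ultimately show ?thesis
      using that by blast
  qed
qed

text \<open>One more plane is split off: an isotropic \<open>x\<close> orthogonal to the earlier
  planes, and a vector \<open>y\<close> with \<open>bil B x y = 1\<close> that is first projected to
  \<open>p\<close>, orthogonal to the earlier planes, and then made isotropic as
  \<open>q\<close>.\<close>

lemma ex_hyperbolic: "2 * k \<le> CARD('n) \<Longrightarrow> \<exists>u w. hyperbolic B k u w"
proof (induction k)
  case 0
  have "hyperbolic B 0 u w" for u w
    by (simp add: hyperbolic_def)
  then show ?case by blast
next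
  case (Suc k)
  then obtain u w where h: "hyperbolic B k u w"
    by auto
  obtain x where x: "x \<noteq> 0" "x \<in> perp B k u w" "bil B x x = 0"
    using ex_isotropic_perp[of k] Suc.prems by (metis Suc_le_eq mult_Suc_right add_2_eq_Suc)
  obtain z where "bil B z x \<noteq> 0"
    using bil_nondegenerate_right[OF B] x(1) by blast
  then have "bil B x z \<noteq> 0"
    using sym[of z x] by auto
  define y where "y = (1 / bil B x z) *s z"
  have xy: "bil B x y = 1"
    using \<open>bil B x z \<noteq> 0\<close> by (simp add: y_def bil_scale_right)
  \<comment> \<open>The factor \<open>s\<close> compensates for
    \<open>bil B (w i) (u i) = s\<close>.\<close>
  define p where "p = y - (\<Sum>i<k. bil B (u i) y *s w i + (s * bil B (w i) y) *s u i)"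
  have ss: "s * s = 1"
    using s by auto
  have perp_x: "bil B (u i) x = 0" "bil B (w i) x = 0" "bil B x (u i) = 0" "bil B x (w i) = 0"
    if "i < k" for i
    using x(2) that sym[of x "u i"] sym[of x "w i"] by (auto simp: perp_def)
  have xp: "bil B x p = 1"
    by (simp add: p_def bil_diff_right bil_sum_right bil_add_right bil_scale_right perp_x xy)
  have up: "bil B (u j) p = 0" if "j < k" for j
  proof -
    have "bil B (u j) (\<Sum>i<k. bil B (u i) y *s w i + (s * bil B (w i) y) *s u i)
      = (\<Sum>i<k. if j = i then bil B (u i) y else 0)"
      unfolding bil_sum_right using h that
      by (intro sum.cong) (auto simp: hyperbolic_def bil_add_right bil_scale_right)
    then show ?thesis
      using that by (simp add: p_def bil_diff_right)
  qed
  have wp: "bil B (w j) p = 0" if "j < k" for j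
  proof -
    have "bil B (w j) (\<Sum>i<k. bil B (u i) y *s w i + (s * bil B (w i) y) *s u i)
      = (\<Sum>i<k. if j = i then bil B (w i) y else 0)"
      unfolding bil_sum_right using h that
      by (intro sum.cong) (auto simp: hyperbolic_def bil_add_right bil_scale_right sym[of "w j" "u _"] ss)
    then show ?thesis
      using that by (simp add: p_def bil_diff_right)
  qed
  \<comment> \<open>For \<open>s = 1\<close> this correction cancels \<open>bil B p p\<close>; for
    \<open>s = -1\<close> that value is already zero.\<close>
  define q where "q = p - (bil B p p / 2) *s x"
  have q: "bil B (u j) q = 0" "bil B (w j) q = 0" "bil B q (u j) = 0" "bil B q (w j) = 0" if "j < k" for j
    using up[OF that] wp[OF that] perp_x[OF that] sym[of q "u j"] sym[of q "w j"]
    by (simp_all add: q_def bil_diff_right bil_scale_right)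
  have xq: "bil B x q = 1"
    by (simp add: q_def bil_diff_right bil_scale_right xp x(3))
  have "bil B p x = s"
    using sym[of p x] xp by simp
  then have "bil B q q = bil B p p - (bil B p p / 2) * (1 + s)"
    by (simp add: q_def bil_diff_left bil_diff_right bil_scale_left bil_scale_right xp x(3) field_simps)
  moreover have "bil B p p = s * bil B p p"
    by (rule sym)
  ultimately have qq: "bil B q q = 0"
    using s by auto
  have "hyperbolic B (Suc k) (u(k := x)) (w(k := q))"
    using h q xq qq perp_x x(3) by (auto simp: hyperbolic_def less_Suc_eq)
  then show ?case
    by blast
qed

text \<open>Let \<open>y\<close> act by \<open>i + 1\<close> on \<open>u i\<close>, by
  \<open>- (i + 1)\<close> on \<open>w i\<close> and by \<open>0\<close> on the vector left over in
  odd dimension. The eigenvalues are distinct, and vectors that pair nontrivially have opposite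
  eigenvalues, so \<open>y\<close> is skew for \<open>B\<close>.\<close>

lemma ex_cyclic_form_alg: "\<exists>y v. y \<in> form_alg B \<and> cyclic y v"
proof -
  define l where "l = CARD('n) div 2"
  obtain u w where h: "hyperbolic B l u w"
    using ex_hyperbolic[of l] by (auto simp: l_def)
  \<comment> \<open>The condition on \<open>z\<close> is vacuous in even dimension, which keeps the
    two parities in one argument.\<close>
  obtain z where z: "2 * l < CARD('n) \<Longrightarrow> z \<noteq> 0 \<and> z \<in> perp B l u w"
    using ex_perp[of l B u w] by metis
  define e where "e k = (if k < l then u k else if k < 2 * l then w (k - l) else z)" for k
  define a where "a k = (if k < l then of_nat (Suc k) else if k < 2 * l then - of_nat (Suc (k - l))
    else 0 :: complex)" for k
  have N: "CARD('n) = 2 * l \<or> CARD('n) = Suc (2 * l)"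
    by (auto simp: l_def)
  have wu: "bil B (w i) (u j) = (if i = j then s else 0)" if "i < l" "j < l" for i j
    using h that sym[of "w i" "u j"] by (auto simp: hyperbolic_def)
  have zz: "bil B (u i) z = 0" "bil B (w i) z = 0" "bil B z (u i) = 0" "bil B z (w i) = 0"
    if "i < l" "2 * l < CARD('n)" for i
    using z that sym[of z "u i"] sym[of z "w i"] by (auto simp: perp_def)
  have ue: "bil B (u j) (e k) = (if k = l + j then 1 else 0)" if "j < l" "k < CARD('n)" for j k
    using h that zz by (auto simp: e_def hyperbolic_def)
  have we: "bil B (w j) (e k) = (if k = j then s else 0)" if "j < l" "k < CARD('n)" for j k
    using h that zz wu by (auto simp: e_def hyperbolic_def)
  have fr: "frame {..<CARD('n)} e"
    unfolding frame_def
  proof (intro conjI allI impI ballI)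
    fix c k assume c: "(\<Sum>k<CARD('n). c k *s e k) = 0" and k: "k \<in> {..<CARD('n)}"
    \<comment> \<open>Pairing with \<open>u j\<close> isolates the coefficient of
      \<open>w j\<close>, which has index \<open>l + j\<close>; pairing with \<open>w j\<close>
      isolates that of \<open>u j\<close>.\<close>
    have 1: "c (l + j) = 0" if "j < l" for j
    proof -
      have "bil B (u j) (\<Sum>k<CARD('n). c k *s e k) = (\<Sum>k<CARD('n). if k = l + j then c k else 0)"
        unfolding bil_sum_right using that by (intro sum.cong) (auto simp: bil_scale_right ue)
      then show ?thesis
        using c that N by auto
    qed
    have 2: "c j = 0" if "j < l" for j
    proof -
      have "bil B (w j) (\<Sum>k<CARD('n). c k *s e k) = (\<Sum>k<CARD('n). if k = j then c k * s else 0)"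
        unfolding bil_sum_right using that by (intro sum.cong) (auto simp: bil_scale_right we)
      then show ?thesis
        using c that N s by auto
    qed
    have lt: "c k = 0" if "k < 2 * l" for k
      using 1[of "k - l"] 2[of k] that by (cases "k < l") auto
    show "c k = 0"
    proof (cases "k < 2 * l")
      case False
      then have k: "k = 2 * l" "CARD('n) = Suc (2 * l)"
        using N k by auto
      have "(\<Sum>k<CARD('n). c k *s e k) = c k *s z"
        using lt by (simp add: k e_def)
      then show ?thesis
        using c z k by simp
    qed (rule lt)
  qed simp_all
  obtain y where y: "\<And>k. k \<in> {..<CARD('n)} \<Longrightarrow> y *v e k = a k *s e k"
    using frame_prescribe[OF fr, of "\<lambda>k. a k *s e k"] by metis
  have "inj_on a {..<CARD('n)}"
  proof (rule inj_onI)
    fix i j assume ij: "i \<in> {..<CARD('n)}" "j \<in> {..<CARD('n)}" and eq: "a i = a j"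
    \<comment> \<open>Real parts reduce the distinctness of the eigenvalues to linear
      arithmetic.\<close>
    have re: "Re (a k) = (if k < l then real k + 1 else if k < 2 * l then - (real (k - l) + 1) else 0)" for k
      by (simp add: a_def)
    show "i = j"
      using ij N arg_cong[OF eq, of Re] unfolding re by (auto split: if_splits)
  qed
  then have "cyclic y (\<Sum>k<CARD('n). e k)"
    using y by (intro cyclic_distinct_eigenvalues[OF fr, of y a]) auto
  moreover have "y \<in> form_alg B"
  proof (rule form_algI, rule frame_bil_ext[OF fr])
    fix i j assume ij: "i \<in> {..<CARD('n)}" "j \<in> {..<CARD('n)}"
    have "(a i + a j) * bil B (e i) (e j) = 0"
    proof (cases "i < l")
      case True
      then show ?thesis
        using ij by (auto simp: ue[of i j] e_def[of i] a_def)
    next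
      case i: False
      show ?thesis
      proof (cases "i < 2 * l")
        case True
        then show ?thesis
          using i ij by (auto simp: we[of "i - l" j] e_def[of i] a_def)
      next
        case False
        then have "2 * l < CARD('n)"
          using ij by auto
        then show ?thesis
          using i False ij zz by (auto simp: e_def a_def)
      qed
    qed
    moreover have "bil (transpose y ** B) (e i) (e j) = a i * bil B (e i) (e j)"
      using y ij by (simp add: bil_mult_left[symmetric] bil_scale_left)
    moreover have "bil (B ** y) (e i) (e j) = a j * bil B (e i) (e j)"
      using y ij by (simp add: bil_mult_right[symmetric] bil_scale_right)
    ultimately show "bil (transpose y ** B) (e i) (e j) = bil (- (B ** y)) (e i) (e j)"
      by (simp add: bil_uminus_mat algebra_simps add_eq_0_iff2)
  qed
  ultimately show ?thesis by blast
qed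

lemma lie_rank_form_alg: "lie_rank (form_alg B) = CARD('n) div 2"
proof -
  obtain y v where "y \<in> form_alg B" "cyclic y v"
    using ex_cyclic_form_alg by blast
  then show ?thesis
    by (rule lie_rank_eq[OF subspace_form_alg]) (simp add: dim_centralizer_cyclic_form[OF _ B])
qed

end

lemma lie_rank_trace_zero: "lie_rank {X :: 'n::finite cmat. trace X = 0} = CARD('n) - 1"
proof -
  obtain y v where "trace (y :: 'n cmat) = 0" "cyclic y v"
    using ex_cyclic_trace_zero by blast
  then show ?thesis
  proof (intro lie_rank_eq[of _ y v] subspace_trace_zero)
    fix x :: "'n cmat" assume "cyclic x v"
    then show "mat.dim (centralizer {X. trace X = 0} {x}) = CARD('n) - 1"
      using dim_centralizer_cyclic[of x v] dim_centralizer_trace_zero[of "{x}"] by simp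
  qed simp_all
qed

section \<open>The two-dimensional torus\<close>

lemma frame_basis:
  fixes v :: "'i \<Rightarrow> complex^'n::finite"
  assumes inj: "inj_on v M" and ind: "vec.independent (v ` M)" and span: "vec.span (v ` M) = UNIV"
  shows "frame M v"
  unfolding frame_def
proof (intro conjI allI impI ballI)
  have fin: "finite (v ` M)"
    using ind by (rule vec.finiteI_independent)
  then show "finite M"
    using inj by (rule finite_imageD)
  have "card (v ` M) = vec.dim (UNIV :: (complex^'n) set)"
    using ind span by (metis vec.dim_span vec.dim_eq_card_independent)
  then show "card M = CARD('n)"
    using inj by (simp add: card_image card_cart_basis)
  fix c k assume c: "(\<Sum>k\<in>M. c k *s v k) = 0" and k: "k \<in> M"
  define g where "g x = c (inv_into M v x)" for x
  have "(\<Sum>x\<in>v ` M. g x *s x) = (\<Sum>k\<in>M. c k *s v k)"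
    using inj by (simp add: sum.reindex g_def)
  then have "g (v k) = 0"
    using vec.independentD[OF ind fin subset_refl, of g "v k"] c k by simp
  then show "c k = 0"
    using inj k by (simp add: g_def)
qed

section \<open>Bases of simultaneous weight vectors\<close>

locale weight_basis =
  fixes E1 H1 E2 H2 :: "'n::finite cmat" and J :: "(nat \<times> nat) list"
    and v :: "nat \<times> nat \<times> nat \<Rightarrow> complex^'n"
  assumes pos: "i < length J \<Longrightarrow> 1 \<le> fst (J ! i) \<and> 1 \<le> snd (J ! i)"
    and fr: "frame (mod_index J) v"
    and H1: "(i, a, b) \<in> mod_index J \<Longrightarrow>
      H1 *v v (i, a, b) = of_int (int (fst (J ! i)) - 1 - 2 * int a) *s v (i, a, b)"
    and E1: "(i, a, b) \<in> mod_index J \<Longrightarrow>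
      E1 *v v (i, a, b) = (if a = 0 then 0 else of_nat (a * (fst (J ! i) - a)) *s v (i, a - 1, b))"
    and H2: "(i, a, b) \<in> mod_index J \<Longrightarrow>
      H2 *v v (i, a, b) = of_int (int (snd (J ! i)) - 1 - 2 * int b) *s v (i, a, b)"
    and E2: "(i, a, b) \<in> mod_index J \<Longrightarrow>
      E2 *v v (i, a, b) = (if b = 0 then 0 else of_nat (b * (snd (J ! i) - b)) *s v (i, a, b - 1))"

lemma decomposes_as_weight_basis:
  assumes "decomposes_as E1 H1 F1 E2 H2 F2 J"
  obtains v where "weight_basis E1 H1 E2 H2 J v"
proof -
  obtain v where v: "inj_on v (mod_index J)" "vec.independent (v ` mod_index J)"
    "vec.span (v ` mod_index J) = UNIV" and act: "\<forall>(i, a, b) \<in> mod_index J.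
           let n = fst (J ! i); m = snd (J ! i) in
           H1 *v v (i, a, b) = of_int (int n - 1 - 2 * int a) *s v (i, a, b) \<and>
           F1 *v v (i, a, b) = (if a + 1 < n then v (i, a + 1, b) else 0) \<and>
           E1 *v v (i, a, b) = (if a = 0 then 0 else of_nat (a * (n - a)) *s v (i, a - 1, b)) \<and>
           H2 *v v (i, a, b) = of_int (int m - 1 - 2 * int b) *s v (i, a, b) \<and>
           F2 *v v (i, a, b) = (if b + 1 < m then v (i, a, b + 1) else 0) \<and>
           E2 *v v (i, a, b) = (if b = 0 then 0 else of_nat (b * (m - b)) *s v (i, a, b - 1))"
    using assms unfolding decomposes_as_def by blast
  have "weight_basis E1 H1 E2 H2 J v"
  proof
    show "frame (mod_index J) v"
      by (rule frame_basis[OF v])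
    fix i a b
    show "1 \<le> fst (J ! i) \<and> 1 \<le> snd (J ! i)" if "i < length J"
      using assms nth_mem[OF that] unfolding decomposes_as_def by (cases "J ! i") fastforce
    assume "(i, a, b) \<in> mod_index J"
    note * = bspec[OF act this, unfolded prod.case Let_def]
    from * show "H1 *v v (i, a, b) = of_int (int (fst (J ! i)) - 1 - 2 * int a) *s v (i, a, b)"
      by blast
    from * show "E1 *v v (i, a, b) = (if a = 0 then 0 else of_nat (a * (fst (J ! i) - a)) *s v (i, a - 1, b))"
      by blast
    from * show "H2 *v v (i, a, b) = of_int (int (snd (J ! i)) - 1 - 2 * int b) *s v (i, a, b)"
      by blast
    from * show "E2 *v v (i, a, b) = (if b = 0 then 0 else of_nat (b * (snd (J ! i) - b)) *s v (i, a, b - 1))"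
      by blast
  qed
  then show ?thesis
    by (rule that)
qed

lemma prod_power_int: "x \<noteq> 0 \<Longrightarrow> (\<Prod>i\<in>I. x powi f i) = x powi (\<Sum>i\<in>I. f i)" for x :: complex
  by (induction I rule: infinite_finite_induct) (auto simp: power_int_add)

context weight_basis
begin

definition wt1 :: "nat \<times> nat \<times> nat \<Rightarrow> int" where
  "wt1 = (\<lambda>(i, a, b). int (fst (J ! i)) - 1 - 2 * int a)"

definition wt2 :: "nat \<times> nat \<times> nat \<Rightarrow> int" where
  "wt2 = (\<lambda>(i, a, b). int (snd (J ! i)) - 1 - 2 * int b)"

text \<open>Reversing both strings of every summand permutes the indices and negates the weights.
  This gives determinant 1 for the torus elements.\<close>

lemma sum_wt: "(\<Sum>k\<in>mod_index J. wt1 k) = 0" "(\<Sum>k\<in>mod_index J. wt2 k) = 0"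
proof -
  define r where "r = (\<lambda>(i, a, b). (i :: nat, fst (J ! i) - 1 - a, snd (J ! i) - 1 - b))"
  have r: "r k \<in> mod_index J" "r (r k) = k" "wt1 (r k) = - wt1 k" "wt2 (r k) = - wt2 k"
    if "k \<in> mod_index J" for k
    using that by (auto simp: r_def mod_index_def wt1_def wt2_def)
  have "(\<Sum>k\<in>mod_index J. wt1 k) = (\<Sum>k\<in>mod_index J. - wt1 k)"
    by (rule sum.reindex_bij_witness[of _ r r]) (auto simp: r)
  then show "(\<Sum>k\<in>mod_index J. wt1 k) = 0"
    by (simp add: sum_negf)
  have "(\<Sum>k\<in>mod_index J. wt2 k) = (\<Sum>k\<in>mod_index J. - wt2 k)"
    by (rule sum.reindex_bij_witness[of _ r r]) (auto simp: r)
  then show "(\<Sum>k\<in>mod_index J. wt2 k) = 0"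
    by (simp add: sum_negf)
qed

text \<open>Since \<open>H1\<close> and \<open>H2\<close> are skew for \<open>B\<close>, weight
  vectors can pair nontrivially only if their weights are opposite.\<close>

lemma bil_weights:
  assumes "H1 \<in> form_alg B" "H2 \<in> form_alg B" "k \<in> mod_index J" "l \<in> mod_index J"
    "bil B (v k) (v l) \<noteq> 0"
  shows "wt1 k + wt1 l = 0" "wt2 k + wt2 l = 0"
proof -
  have H: "H1 *v v k = of_int (wt1 k) *s v k" "H2 *v v k = of_int (wt2 k) *s v k" if "k \<in> mod_index J" for k
    using that H1 H2 by (auto simp: wt1_def wt2_def split: prod.splits)
  have gen: "a + b = 0" if "H \<in> form_alg B" "H *v v k = of_int a *s v k" "H *v v l = of_int b *s v l" for H a b
  proof -
    have "bil B (H *v v k) (v l) = - bil B (v k) (H *v v l)"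
      using form_algD[OF that(1)] by (simp add: bil_mult_left bil_mult_right bil_uminus_mat)
    then have "(of_int a + of_int b) * bil B (v k) (v l) = 0"
      by (simp add: that bil_scale_left bil_scale_right algebra_simps)
    then have "of_int (a + b) = (0 :: complex)"
      using assms(5) by simp
    then show ?thesis
      by (simp only: of_int_eq_0_iff)
  qed
  show "wt1 k + wt1 l = 0" "wt2 k + wt2 l = 0"
    using gen assms H by blast+
qed

text \<open>On each weight vector \<open>g\<close> acts by \<open>s1\<close> and \<open>s2\<close>
  raised to the two weights. Each \<open>E\<close> raises its own weight by 2 and fixes the other,
  so square roots of \<open>t1\<close> and \<open>t2\<close> are taken. Opposite weights cancel,
  which is why forms with \<open>H1\<close> and \<open>H2\<close> skew are preserved.\<close>

lemma ex_torus_element: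
  assumes "t1 \<noteq> 0" "t2 \<noteq> 0"
  obtains g where "det g = 1" "Ad g E1 = mscale t1 E1" "Ad g E2 = mscale t2 E2"
    "\<And>B. H1 \<in> form_alg B \<Longrightarrow> H2 \<in> form_alg B \<Longrightarrow> transpose g ** B ** g = B"
proof -
  define s1 s2 where "s1 = csqrt t1" and "s2 = csqrt t2"
  have s: "s1 \<noteq> 0" "s2 \<noteq> 0" "s1 powi 2 = t1" "s2 powi 2 = t2"
    using assms by (simp_all add: s1_def s2_def)
  define d where "d k = s1 powi wt1 k * s2 powi wt2 k" for k
  obtain g where g: "\<And>k. k \<in> mod_index J \<Longrightarrow> g *v v k = d k *s v k"
    using frame_prescribe[OF fr, of "\<lambda>k. d k *s v k"] by metis
  have det: "det g = 1"
    using frame_det_diag[OF fr g] by (simp add: d_def prod.distrib prod_power_int s sum_wt)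
  then have inv: "invertible g"
    by (simp add: invertible_det_nz)
  have Ad: "Ad g E = mscale t E" if "g ** E = mscale t (E ** g)" for E t
    unfolding Ad_def that mscale_mult_left
    by (simp add: matrix_mul_assoc[symmetric] matrix_inv_inverse[OF inv])
  have "g ** E1 = mscale t1 (E1 ** g)"
  proof (rule frame_ext[OF fr])
    fix k assume "k \<in> mod_index J"
    then obtain i a b where k: "k = (i, a, b)" "(i, a, b) \<in> mod_index J"
      by (cases k) auto
    show "(g ** E1) *v v k = mscale t1 (E1 ** g) *v v k"
    proof (cases "a = 0")
      case False
      then have k': "(i, a - 1, b) \<in> mod_index J"
        using k by (auto simp: mod_index_def)
      have "wt1 (i, a - 1, b) = 2 + wt1 (i, a, b)" "wt2 (i, a - 1, b) = wt2 (i, a, b)"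
        using False by (auto simp: wt1_def wt2_def)
      then have "d (i, a - 1, b) = t1 * d k"
        using s by (simp add: d_def k power_int_add)
      then show ?thesis
        using False k k' by (simp add: matrix_vector_mul_assoc[symmetric] mscale_mult_vec E1 g
            vector_scalar_commute vector_smult_assoc mult_ac)
    qed (use k in \<open>simp add: matrix_vector_mul_assoc[symmetric] mscale_mult_vec E1 g vector_scalar_commute\<close>)
  qed
  moreover have "g ** E2 = mscale t2 (E2 ** g)"
  proof (rule frame_ext[OF fr])
    fix k assume "k \<in> mod_index J"
    then obtain i a b where k: "k = (i, a, b)" "(i, a, b) \<in> mod_index J"
      by (cases k) auto
    show "(g ** E2) *v v k = mscale t2 (E2 ** g) *v v k"
    proof (cases "b = 0")
      case False
      then have k': "(i, a, b - 1) \<in> mod_index J"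
        using k by (auto simp: mod_index_def)
      have "wt2 (i, a, b - 1) = 2 + wt2 (i, a, b)" "wt1 (i, a, b - 1) = wt1 (i, a, b)"
        using False by (auto simp: wt1_def wt2_def)
      then have "d (i, a, b - 1) = t2 * d k"
        using s by (simp add: d_def k power_int_add)
      then show ?thesis
        using False k k' by (simp add: matrix_vector_mul_assoc[symmetric] mscale_mult_vec E2 g
            vector_scalar_commute vector_smult_assoc mult_ac)
    qed (use k in \<open>simp add: matrix_vector_mul_assoc[symmetric] mscale_mult_vec E2 g vector_scalar_commute\<close>)
  qed
  moreover have "transpose g ** B ** g = B" if H: "H1 \<in> form_alg B" "H2 \<in> form_alg B" for B
  proof (rule frame_bil_ext[OF fr])
    fix k l assume kl: "k \<in> mod_index J" "l \<in> mod_index J"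
    have "bil (transpose g ** B ** g) (v k) (v l) = bil B (g *v v k) (g *v v l)"
      by (simp add: bil_mult_left bil_mult_right matrix_mul_assoc)
    also have "\<dots> = d k * d l * bil B (v k) (v l)"
      by (simp add: g kl bil_scale_left bil_scale_right)
    also have "\<dots> = bil B (v k) (v l)"
    proof (cases "bil B (v k) (v l) = 0")
      case False
      have "d k * d l = s1 powi (wt1 k + wt1 l) * s2 powi (wt2 k + wt2 l)"
        using s by (simp add: d_def power_int_add)
      then show ?thesis
        using bil_weights[OF H kl False] by simp
    qed simp
    finally show "bil (transpose g ** B ** g) (v k) (v l) = bil B (v k) (v l)" .
  qed
  ultimately show ?thesis
    using that[of g] det Ad by blast
qed

end

section \<open>Invariant bilinear forms\<close>

lemma frame_rescale_involution:
  assumes fr: "frame I v" and r: "\<And>k. k \<in> I \<Longrightarrow> r k \<in> I \<and> r (r k) = k"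
    and w: "\<And>k. k \<in> I \<Longrightarrow> \<exists>c. c \<noteq> 0 \<and> w k = c *s v (r k)"
  shows "frame I w"
  unfolding frame_def
proof (intro conjI allI impI ballI)
  obtain a where a: "\<And>k. k \<in> I \<Longrightarrow> a k \<noteq> 0 \<and> w k = a k *s v (r k)"
    using bchoice[of I "\<lambda>k c. c \<noteq> 0 \<and> w k = c *s v (r k)"] w by blast
  fix c k assume c: "(\<Sum>k\<in>I. c k *s w k) = 0" and k: "k \<in> I"
  have "(\<Sum>k\<in>I. c k *s w k) = (\<Sum>k\<in>I. (c (r k) * a (r k)) *s v k)"
    by (rule sum.reindex_bij_witness[of _ r r]) (auto simp: r a vector_smult_assoc)
  then have "(\<Sum>k\<in>I. (c (r k) * a (r k)) *s v k) = 0"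
    using c by simp
  then have "\<forall>k\<in>I. c (r k) * a (r k) = 0"
    using fr[unfolded frame_def, THEN conjunct2, THEN conjunct2, THEN spec,
        of "\<lambda>k. c (r k) * a (r k)"] by simp
  from bspec[OF this, of "r k"] show "c k = 0"
    using k r a by auto
qed (use fr in \<open>auto simp: frame_def\<close>)

context weight_basis
begin

abbreviation nn :: "nat \<Rightarrow> nat" where "nn i \<equiv> fst (J ! i)"
abbreviation mm :: "nat \<Rightarrow> nat" where "mm i \<equiv> snd (J ! i)"

lemma E_commute: "E1 ** E2 = E2 ** E1"
proof (rule frame_ext[OF fr])
  fix k assume "k \<in> mod_index J"
  then obtain i a b where k: "k = (i, a, b)" "(i, a, b) \<in> mod_index J"
    by (cases k) auto
  then have "a \<noteq> 0 \<Longrightarrow> (i, a - 1, b) \<in> mod_index J" "b \<noteq> 0 \<Longrightarrow> (i, a, b - 1) \<in> mod_index J"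
    by (auto simp: mod_index_def)
  then show "(E1 ** E2) *v v k = (E2 ** E1) *v v k"
    using k by (cases "a = 0"; cases "b = 0")
      (simp_all add: matrix_vector_mul_assoc[symmetric] E1 E2 vector_scalar_commute
        vector_smult_assoc mult.commute)
qed

text \<open>The vectors \<open>gen i\<close> are lowest weight vectors, so each summand is the cyclic module
  \<open>\<complex>[x, y] / (x ^ nn i, y ^ mm i)\<close> under \<open>x = E1\<close>, \<open>y = E2\<close>, with monomial basis \<open>w\<close>.\<close>

definition gen :: "nat \<Rightarrow> complex^'n" where
  "gen i = v (i, nn i - 1, mm i - 1)"

definition w :: "nat \<Rightarrow> nat \<Rightarrow> nat \<Rightarrow> complex^'n" where
  "w i a b = mpow E1 a *v (mpow E2 b *v gen i)"

lemma w_0 [simp]: "w i 0 0 = gen i"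
  by (simp add: w_def)

lemma mpow_commute2: "mpow E1 a ** mpow E2 b = mpow E2 b ** mpow E1 a"
  by (rule mpow_commute[OF mpow_commute[OF E_commute[symmetric], symmetric]])

lemma mpow_w: "mpow E1 c *v w i a b = w i (c + a) b" "mpow E2 d *v w i a b = w i a (d + b)"
proof -
  show "mpow E1 c *v w i a b = w i (c + a) b"
    by (simp add: w_def mpow_add matrix_vector_mul_assoc matrix_mul_assoc)
  have "mpow E2 d *v w i a b = (mpow E2 d ** mpow E1 a ** mpow E2 b) *v gen i"
    by (simp add: w_def matrix_vector_mul_assoc matrix_mul_assoc)
  also have "\<dots> = w i a (d + b)"
    by (simp add: w_def mpow_commute2[symmetric] mpow_add matrix_vector_mul_assoc matrix_mul_assoc)
  finally show "mpow E2 d *v w i a b = w i a (d + b)" .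
qed

lemma E_w: "E1 *v w i a b = w i (Suc a) b" "E2 *v w i a b = w i a (Suc b)"
  using mpow_w(1)[of 1 i a b] mpow_w(2)[of 1 i a b] by (simp_all add: mpow_Suc)

text \<open>Each application of \<open>E1\<close> or \<open>E2\<close> moves one step up a string
  with a factor \<open>x * (n - x)\<close>, nonzero for \<open>0 < x < n\<close>. The monomial basis
  is thus the weight basis, reversed and rescaled.\<close>

lemma w_eq_v:
  assumes "i < length J" "a < nn i" "b < mm i"
  shows "\<exists>c. c \<noteq> 0 \<and> w i a b = c *s v (i, nn i - 1 - a, mm i - 1 - b)"
  using assms(2,3)
proof (induction a)
  case 0
  from 0(2) show ?case
  proof (induction b)
    case 0
    show ?case
      by (intro exI[of _ 1]) (simp add: gen_def)
  next
    case (Suc b)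
    then obtain c where c: "c \<noteq> 0" "w i 0 b = c *s v (i, nn i - 1, mm i - 1 - b)"
      by auto
    define x where "x = mm i - 1 - b"
    have x: "x \<noteq> 0" "x < mm i" "x - 1 = mm i - 1 - Suc b"
      using Suc.prems by (auto simp: x_def)
    have k: "(i, nn i - 1, x) \<in> mod_index J"
      using pos[OF assms(1)] x assms(1) by (auto simp: mod_index_def)
    have "w i 0 (Suc b) = E2 *v (c *s v (i, nn i - 1, x))"
      by (simp only: E_w[symmetric] c x_def)
    also have "\<dots> = (c * of_nat (x * (mm i - x))) *s v (i, nn i - 1, mm i - 1 - Suc b)"
      using x by (simp only: vector_scalar_commute E2[OF k] if_False vector_smult_assoc)
    finally have "w i 0 (Suc b) = (c * of_nat (x * (mm i - x))) *s v (i, nn i - 1, mm i - 1 - Suc b)" .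
    moreover have "c * of_nat (x * (mm i - x)) \<noteq> 0"
      using c x by auto
    ultimately show ?case
      by (intro exI[of _ "c * of_nat (x * (mm i - x))"]) simp
  qed
next
  case (Suc a)
  then obtain c where c: "c \<noteq> 0" "w i a b = c *s v (i, nn i - 1 - a, mm i - 1 - b)"
    by auto
  define x where "x = nn i - 1 - a"
  have x: "x \<noteq> 0" "x < nn i" "x - 1 = nn i - 1 - Suc a"
    using Suc.prems by (auto simp: x_def)
  have k: "(i, x, mm i - 1 - b) \<in> mod_index J"
    using x assms by (auto simp: mod_index_def)
  have "w i (Suc a) b = E1 *v (c *s v (i, x, mm i - 1 - b))"
    by (simp only: E_w[symmetric] c x_def)
  also have "\<dots> = (c * of_nat (x * (nn i - x))) *s v (i, nn i - 1 - Suc a, mm i - 1 - b)"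
    using x by (simp only: vector_scalar_commute E1[OF k] if_False vector_smult_assoc)
  finally have "w i (Suc a) b = (c * of_nat (x * (nn i - x))) *s v (i, nn i - 1 - Suc a, mm i - 1 - b)" .
  moreover have "c * of_nat (x * (nn i - x)) \<noteq> 0"
    using c x by auto
  ultimately show ?case
    by blast
qed

lemma w_frame: "frame (mod_index J) (\<lambda>(i, a, b). w i a b)"
proof (rule frame_rescale_involution[OF fr, of "\<lambda>(i, a, b). (i, nn i - 1 - a, mm i - 1 - b)"])
  fix k assume k: "k \<in> mod_index J"
  then show "\<exists>c. c \<noteq> 0 \<and> (case k of (i, a, b) \<Rightarrow> w i a b) =
      c *s v (case k of (i, a, b) \<Rightarrow> (i, nn i - 1 - a, mm i - 1 - b))"
    using w_eq_v[of "fst k" "fst (snd k)" "snd (snd k)"] by (auto simp: mod_index_def)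
qed (auto simp: mod_index_def)

text \<open>\<open>E1\<close> and \<open>E2\<close> annihilate the ends of their strings, so
  \<open>mpow E1 (nn i)\<close> and \<open>mpow E2 (mm i)\<close> kill the generator, and further
  powers preserve zero.\<close>

lemma w_zero:
  assumes i: "i < length J" and "nn i \<le> a \<or> mm i \<le> b"
  shows "w i a b = 0"
proof -
  have "w i (nn i) 0 = 0"
  proof -
    obtain c where "w i (nn i - 1) 0 = c *s v (i, 0, mm i - 1)"
      using w_eq_v[OF i, of "nn i - 1" 0] pos[OF i] by auto
    moreover have "(i, 0, mm i - 1) \<in> mod_index J"
      using pos[OF i] i by (auto simp: mod_index_def)
    ultimately have "E1 *v w i (nn i - 1) 0 = 0"
      by (simp add: vector_scalar_commute E1)
    then show ?thesis
      using pos[OF i] by (simp add: E_w)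
  qed
  then have 1: "w i (c + nn i) d = 0" for c d
    using mpow_w(1)[of c i "nn i" d] mpow_w(2)[of d i "nn i" 0] by simp
  have "w i 0 (mm i) = 0"
  proof -
    obtain c where "w i 0 (mm i - 1) = c *s v (i, nn i - 1, 0)"
      using w_eq_v[OF i, of 0 "mm i - 1"] pos[OF i] by auto
    moreover have "(i, nn i - 1, 0) \<in> mod_index J"
      using pos[OF i] i by (auto simp: mod_index_def)
    ultimately have "E2 *v w i 0 (mm i - 1) = 0"
      by (simp add: vector_scalar_commute E2)
    then show ?thesis
      using pos[OF i] by (simp add: E_w)
  qed
  then have 2: "w i c (d + mm i) = 0" for c d
    using mpow_w(1)[of c i 0 "d + mm i"] mpow_w(2)[of d i 0 "mm i"] by simp
  show ?thesis
    using assms(2) 1[of "a - nn i" b] 2[of a "b - mm i"] by auto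
qed

text \<open>Here the form is the unknown: \<open>Y\<close> ranges over the forms for which
  \<open>E1\<close> and \<open>E2\<close> are skew.\<close>

definition invariant :: "'n cmat \<Rightarrow> bool" where
  "invariant Y \<longleftrightarrow> E1 \<in> form_alg Y \<and> E2 \<in> form_alg Y"

lemma bil_mpow_left:
  assumes "E \<in> form_alg Y"
  shows "bil Y (mpow E a *v x) y = (-1) ^ a * bil Y x (mpow E a *v y)"
  by (simp add: bil_mult_left form_alg_mpow[OF assms] bil_scale_mat bil_mult_right)

text \<open>All powers move to the right argument, each with a sign. An invariant form is thus
  determined by the numbers \<open>bil Y (gen i) (w j s t)\<close>, the parameters counted
  below.\<close>

lemma invariant_bil_w:
  assumes "invariant Y"
  shows "bil Y (w i a b) (w j c d) = (-1) ^ (a + b) * bil Y (gen i) (w j (a + c) (b + d))"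
  unfolding w_def[of i]
  using assms by (simp add: invariant_def bil_mpow_left mpow_w power_add mult.assoc)

text \<open>Outside the rectangle of summand \<open>j\<close> the vector \<open>w j s t\<close>
  vanishes; outside that of \<open>i\<close>, moving the powers back to the left gives
  \<open>w i s t = 0\<close>.\<close>

lemma invariant_phi_zero:
  assumes Y: "invariant Y" and i: "i < length J" and j: "j < length J"
    and st: "\<not> (s < min (nn i) (nn j) \<and> t < min (mm i) (mm j))"
  shows "bil Y (gen i) (w j s t) = 0"
proof (cases "nn j \<le> s \<or> mm j \<le> t")
  case True
  then show ?thesis
    by (simp add: w_zero[OF j])
next
  case False
  then have "w i s t = 0"
    using st by (intro w_zero[OF i]) auto
  then show ?thesis
    using invariant_bil_w[OF Y, of i s t j 0 0] by simp
qed

lemma invariant_eq_zero: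
  assumes Y: "invariant Y"
    and zero: "\<And>i j s t. i < length J \<Longrightarrow> j < length J \<Longrightarrow> s < min (nn i) (nn j) \<Longrightarrow>
      t < min (mm i) (mm j) \<Longrightarrow> bil Y (gen i) (w j s t) = 0"
  shows "Y = 0"
proof (rule frame_bil_ext[OF w_frame])
  fix k l assume kl: "k \<in> mod_index J" "l \<in> mod_index J"
  obtain i a b j c d where *: "k = (i, a, b)" "l = (j, c, d)"
    by (cases k, cases l) auto
  then have ij: "i < length J" "j < length J"
    using kl by (auto simp: mod_index_def)
  have "bil Y (gen i) (w j (a + c) (b + d)) = 0"
    using zero[OF ij] invariant_phi_zero[OF Y ij] by blast
  then show "bil Y (case k of (i, a, b) \<Rightarrow> w i a b) (case l of (i, a, b) \<Rightarrow> w i a b) =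
      bil 0 (case k of (i, a, b) \<Rightarrow> w i a b) (case l of (i, a, b) \<Rightarrow> w i a b)"
    by (simp add: * invariant_bil_w[OF Y])
qed

text \<open>The formula of \<open>invariant_bil_w\<close> defines \<open>Y\<close> on the frame. The
  support condition extends it to exponents beyond the frame, and skewness of \<open>E1\<close> and
  \<open>E2\<close> then amounts to shifting an exponent from one argument to the other.\<close>

lemma ex_invariant:
  fixes f :: "nat \<Rightarrow> nat \<Rightarrow> nat \<Rightarrow> nat \<Rightarrow> complex"
  assumes supp: "\<And>i j s t. i < length J \<Longrightarrow> j < length J \<Longrightarrow>
    \<not> (s < min (nn i) (nn j) \<and> t < min (mm i) (mm j)) \<Longrightarrow> f i j s t = 0"
  shows "\<exists>Y. invariant Y \<and> (\<forall>i j a b c d. i < length J \<longrightarrow> j < length J \<longrightarrow>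
      bil Y (w i a b) (w j c d) = (-1) ^ (a + b) * f i j (a + c) (b + d))"
proof -
  obtain Y where Y: "\<And>k l. k \<in> mod_index J \<Longrightarrow> l \<in> mod_index J \<Longrightarrow>
      bil Y (case k of (i, a, b) \<Rightarrow> w i a b) (case l of (i, a, b) \<Rightarrow> w i a b) =
      (case k of (i, a, b) \<Rightarrow> case l of (j, c, d) \<Rightarrow> (-1) ^ (a + b) * f i j (a + c) (b + d))"
    by (rule frame_bil_prescribe[OF w_frame, of "\<lambda>k l. case k of (i, a, b) \<Rightarrow> case l of (j, c, d) \<Rightarrow>
      (-1) ^ (a + b) * f i j (a + c) (b + d)"]) blast
  have bil: "bil Y (w i a b) (w j c d) = (-1) ^ (a + b) * f i j (a + c) (b + d)"
    if ij: "i < length J" "j < length J" for i j a b c d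
  proof (cases "a < nn i \<and> b < mm i \<and> c < nn j \<and> d < mm j")
    case True
    then show ?thesis
      using Y[of "(i, a, b)" "(j, c, d)"] ij by (simp add: mod_index_def)
  next
    case False
    then have "w i a b = 0 \<or> w j c d = 0"
      using w_zero ij by (meson not_le)
    \<comment> \<open>An exponent too large on one side makes the sum exceed the minimum of the two
      bounds.\<close>
    moreover have "f i j (a + c) (b + d) = 0"
      using False by (intro supp ij) auto
    ultimately show ?thesis
      by auto
  qed
  have "E1 \<in> form_alg Y"
  proof (rule form_algI, rule frame_bil_ext[OF w_frame])
    fix k l assume kl: "k \<in> mod_index J" "l \<in> mod_index J"
    obtain i a b j c d where *: "k = (i, a, b)" "l = (j, c, d)"
      by (cases k, cases l) auto
    then have ij: "i < length J" "j < length J"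
      using kl by (auto simp: mod_index_def)
    show "bil (transpose E1 ** Y) (case k of (i, a, b) \<Rightarrow> w i a b) (case l of (i, a, b) \<Rightarrow> w i a b) =
      bil (- (Y ** E1)) (case k of (i, a, b) \<Rightarrow> w i a b) (case l of (i, a, b) \<Rightarrow> w i a b)"
      by (simp add: * bil_mult_left[of Y, symmetric] bil_mult_right[of Y, symmetric] bil_uminus_mat E_w bil ij)
  qed
  moreover have "E2 \<in> form_alg Y"
  proof (rule form_algI, rule frame_bil_ext[OF w_frame])
    fix k l assume kl: "k \<in> mod_index J" "l \<in> mod_index J"
    obtain i a b j c d where *: "k = (i, a, b)" "l = (j, c, d)"
      by (cases k, cases l) auto
    then have ij: "i < length J" "j < length J"
      using kl by (auto simp: mod_index_def)
    show "bil (transpose E2 ** Y) (case k of (i, a, b) \<Rightarrow> w i a b) (case l of (i, a, b) \<Rightarrow> w i a b) =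
      bil (- (Y ** E2)) (case k of (i, a, b) \<Rightarrow> w i a b) (case l of (i, a, b) \<Rightarrow> w i a b)"
      by (simp add: * bil_mult_left[of Y, symmetric] bil_mult_right[of Y, symmetric] bil_uminus_mat E_w bil ij)
  qed
  ultimately show ?thesis
    using bil by (intro exI[of _ Y]) (simp add: invariant_def)
qed

text \<open>For \<open>E\<close> skew for \<open>B\<close>, skewness for \<open>B ** X\<close> says
  \<open>B ** (X ** E) = B ** (E ** X)\<close>, and \<open>B\<close> cancels.\<close>

lemma invariant_mult_iff:
  assumes B: "invertible B" and inv: "invariant B"
  shows "invariant (B ** X) \<longleftrightarrow> X ** E1 = E1 ** X \<and> X ** E2 = E2 ** X"
proof -
  have "E \<in> form_alg (B ** X) \<longleftrightarrow> X ** E = E ** X" if E: "E \<in> form_alg B" for E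
  proof -
    have "transpose E ** (B ** X) = - (B ** (E ** X))"
      by (simp add: matrix_mul_assoc form_algD[OF E] matrix_minus_left)
    then have "E \<in> form_alg (B ** X) \<longleftrightarrow> B ** (X ** E) = B ** (E ** X)"
      by (auto simp: form_alg_def matrix_mul_assoc)
    also have "\<dots> \<longleftrightarrow> X ** E = E ** X"
      using matrix_inv_inverse(2)[OF B] by (metis matrix_mul_assoc matrix_mul_lid)
    finally show ?thesis .
  qed
  then show ?thesis
    using inv by (simp add: invariant_def)
qed

text \<open>For \<open>sl(V)\<close> no invariant form is given, so an auxiliary nondegenerate
  \<open>B\<close> is built. Then \<open>X\<close> centralizes the pair exactly when
  \<open>B ** X\<close> is invariant, and the invariant forms are counted by their free
  parameters.\<close>

lemma dim_centralizer_gl: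
  "mat.dim (centralizer UNIV {E1, E2}) =
    card {(i, j, s, t). i < length J \<and> j < length J \<and> s < min (nn i) (nn j) \<and> t < min (mm i) (mm j)}"
    (is "_ = card ?K")
proof -
  \<comment> \<open>Only the top monomial of each summand has a nonzero coefficient, so
    \<open>B\<close> pairs a monomial just with the complementary one in its own summand.\<close>
  define f0 where "f0 i j s t = (if i = j \<and> Suc s = nn i \<and> Suc t = mm i then 1 else 0 :: complex)"
    for i j s t
  have "\<exists>B. invariant B \<and> (\<forall>i j a b c d. i < length J \<longrightarrow> j < length J \<longrightarrow>
      bil B (w i a b) (w j c d) = (-1) ^ (a + b) * f0 i j (a + c) (b + d))"
    by (rule ex_invariant) (auto simp: f0_def)
  then obtain B where B: "invariant B" "\<And>i j a b c d. i < length J \<Longrightarrow> j < length J \<Longrightarrow>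
      bil B (w i a b) (w j c d) = (-1) ^ (a + b) * f0 i j (a + c) (b + d)"
    by blast
  have invB: "invertible B"
    unfolding invertible_left_inverse matrix_left_invertible_ker
  proof (intro allI impI)
    fix u assume "B *v u = 0"
    then have Bu: "bil B x u = 0" for x
      by (simp add: bil_def)
    let ?c = "frame_coord (mod_index J) (\<lambda>(i, a, b). w i a b)"
    have u: "(\<Sum>k\<in>mod_index J. ?c k u *s (case k of (i, a, b) \<Rightarrow> w i a b)) = u"
      by (rule frame_expand[OF w_frame])
    have "?c k u = 0" if k: "k \<in> mod_index J" for k
    proof -
      obtain i a b where *: "k = (i, a, b)"
        by (cases k) auto
      have i: "i < length J" "a < nn i" "b < mm i"
        using k * by (auto simp: mod_index_def)
      \<comment> \<open>Pairing with the complementary monomial isolates the coordinate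
        \<open>?c k u\<close>, up to the sign \<open>\<sigma>\<close>.\<close>
      define z where "z = w i (nn i - 1 - a) (mm i - 1 - b)"
      define \<sigma> where "\<sigma> = (-1 :: complex) ^ (nn i - 1 - a + (mm i - 1 - b))"
      have "bil B z (case l of (j, c, d) \<Rightarrow> w j c d) = (if l = k then \<sigma> else 0)"
        if "l \<in> mod_index J" for l
        using that i by (auto simp: * z_def \<sigma>_def B(2) f0_def mod_index_def split: prod.splits)
      then have "(\<Sum>l\<in>mod_index J. ?c l u * bil B z (case l of (j, c, d) \<Rightarrow> w j c d))
        = (\<Sum>l\<in>mod_index J. if l = k then ?c k u * \<sigma> else 0)"
        by (intro sum.cong) auto
      also have "\<dots> = ?c k u * \<sigma>"
        using k fr by (simp add: frame_def)
      also have "(\<Sum>l\<in>mod_index J. ?c l u * bil B z (case l of (j, c, d) \<Rightarrow> w j c d)) = bil B z u"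
        using arg_cong[OF u, of "bil B z"] by (simp add: bil_sum_right bil_scale_right)
      finally show ?thesis
        by (simp add: Bu \<sigma>_def)
    qed
    then have "(\<Sum>k\<in>mod_index J. ?c k u *s (case k of (i, a, b) \<Rightarrow> w i a b)) = 0"
      by (intro sum.neutral) simp
    then show "u = 0"
      by (simp only: u)
  qed
  let ?f = "\<lambda>(i, j, s, t) X. bil (B ** X) (gen i) (w j s t)"
  have ex: "\<exists>X. X \<in> centralizer UNIV {E1, E2} \<and> (\<forall>k\<in>?K. ?f k X = (if k = l then 1 else 0))"
    if l: "l \<in> ?K" for l
  proof -
    have "\<exists>Y. invariant Y \<and> (\<forall>i j a b c d. i < length J \<longrightarrow> j < length J \<longrightarrow>
      bil Y (w i a b) (w j c d) = (-1) ^ (a + b) * (if (i, j, a + c, b + d) = l then 1 else 0))"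
      by (rule ex_invariant) (use l in auto)
    then obtain Y where Y: "invariant Y" "\<And>i j a b c d. i < length J \<Longrightarrow> j < length J \<Longrightarrow>
      bil Y (w i a b) (w j c d) = (-1) ^ (a + b) * (if (i, j, a + c, b + d) = l then 1 else 0)"
      by blast
    define X where "X = matrix_inv B ** Y"
    have BX: "B ** X = Y"
      by (simp add: X_def matrix_mul_assoc matrix_inv_inverse[OF invB])
    have "X \<in> centralizer UNIV {E1, E2}"
      using invariant_mult_iff[OF invB B(1), of X] Y(1) by (simp add: BX centralizer_iff)
    moreover have "?f k X = (if k = l then 1 else 0)" if "k \<in> ?K" for k
      using that Y(2)[of "fst k" "fst (snd k)" 0 0] by (auto simp: BX)
    ultimately show ?thesis
      by blast
  qed
  define b where "b l = (SOME X. X \<in> centralizer UNIV {E1, E2} \<and> (\<forall>k\<in>?K. ?f k X = (if k = l then 1 else 0)))" for l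
  have b: "b l \<in> centralizer UNIV {E1, E2} \<and> (\<forall>k\<in>?K. ?f k (b l) = (if k = l then 1 else 0))" if "l \<in> ?K" for l
    unfolding b_def by (rule someI_ex[OF ex[OF that]])
  show ?thesis
  proof (rule mat.dim_eq_card_dual_functionals(2)[where f = ?f and b = b])
    show "finite ?K"
      by (rule finite_subset[of _ "{..<length J} \<times> {..<length J} \<times> (\<Union>i<length J. {..<nn i}) \<times> (\<Union>i<length J. {..<mm i})"]) auto
    show "X = 0" if X: "X \<in> centralizer UNIV {E1, E2}" and 0: "\<And>k. k \<in> ?K \<Longrightarrow> ?f k X = 0" for X
    proof -
      have "B ** X = 0"
      proof (rule invariant_eq_zero)
        show "invariant (B ** X)"
          using X by (simp add: invariant_mult_iff[OF invB B(1)] centralizer_iff)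
        show "bil (B ** X) (gen i) (w j s t) = 0" if "i < length J" "j < length J"
          "s < min (nn i) (nn j)" "t < min (mm i) (mm j)" for i j s t
          using 0[of "(i, j, s, t)"] that by simp
      qed
      then have "matrix_inv B ** (B ** X) = 0"
        by simp
      then show ?thesis
        by (simp add: matrix_mul_assoc matrix_inv_inverse[OF invB])
    qed
    show "?f k (X + Y) = ?f k X + ?f k Y" "?f k (mscale c X) = c * ?f k X" for k X Y c
      by (simp_all add: matrix_add_ldistrib bil_add_mat mscale_mult_right bil_scale_mat split: prod.split)
    show "b k \<in> centralizer UNIV {E1, E2}" if "k \<in> ?K" for k
      by (rule b[OF that, THEN conjunct1])
    show "?f k (b l) = (if k = l then 1 else 0)" if "k \<in> ?K" "l \<in> ?K" for k l
      by (rule bspec[OF b[OF that(2), THEN conjunct2] that(1)])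
  qed (intro subspace_centralizer mat.subspace_UNIV)
qed

text \<open>Here \<open>e = 1\<close> is the symplectic case and \<open>e = -1\<close> the
  orthogonal one. Membership of \<open>X\<close> in \<open>form_alg B\<close> means that
  \<open>B ** X\<close> has symmetry sign \<open>e\<close>. This determines the parameters at
  \<open>(j, i)\<close> by those at \<open>(i, j)\<close>, and on the diagonal leaves only
  \<open>(s, t)\<close> with \<open>e = (-1) ^ (s + t)\<close>.\<close>

lemma dim_centralizer_form_alg:
  assumes B: "invertible B" "invariant B" and sym: "transpose B = mscale (- e) B"
    and e: "e = 1 \<or> e = -1"
  shows "mat.dim (centralizer (form_alg B) {E1, E2}) =
    card {(i, j, s, t). i \<le> j \<and> j < length J \<and> s < min (nn i) (nn j) \<and> t < min (mm i) (mm j) \<and>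
      (i = j \<longrightarrow> e = (-1) ^ (s + t))}"
    (is "_ = card ?K")
proof -
  let ?S = "centralizer (form_alg B) {E1, E2}"
  have ee: "e * e = 1"
    using e by auto
  have S_iff: "X \<in> ?S \<longleftrightarrow> invariant (B ** X) \<and> transpose (B ** X) = mscale e (B ** X)" for X
  proof -
    have "transpose (B ** X) = - mscale e (transpose X ** B)"
      by (simp add: matrix_transpose_mul sym mscale_mult_right matrix_minus_right)
    then have "X \<in> form_alg B \<longleftrightarrow> transpose (B ** X) = mscale e (B ** X)"
    proof -
      assume tr: "transpose (B ** X) = - mscale e (transpose X ** B)"
      from e show ?thesis
      proof
        assume "e = 1"
        then show ?thesis
          by (simp add: tr form_alg_def add_eq_0_iff) metis
      next
        assume "e = -1"
        then show ?thesis
          by (simp add: tr form_alg_def mscale_uminus_one add_eq_0_iff2)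
      qed
    qed
    then show ?thesis
      by (auto simp: centralizer_iff invariant_mult_iff[OF B])
  qed
  have sgn: "(-1 :: complex) ^ n * (-1) ^ n = 1" for n
    by (metis left_minus_one_mult_self mult.right_neutral)
  let ?f = "\<lambda>(i, j, s, t) X. bil (B ** X) (gen i) (w j s t)"
  have ex: "\<exists>X. X \<in> ?S \<and> (\<forall>k\<in>?K. ?f k X = (if k = l then 1 else 0))"
    if l: "l \<in> ?K" for l
  proof -
    \<comment> \<open>The parameter \<open>l\<close> is set to 1 and its mirror image to the value
      forced by symmetry. For a diagonal \<open>l\<close> both are the same entry, and the parity
      condition makes the values agree.\<close>
    define f where "f i j s t = (if (i, j, s, t) = l then 1 else if (j, i, s, t) = l then e * (-1) ^ (s + t) else 0)"
      for i j s t
    have "\<exists>Y. invariant Y \<and> (\<forall>i j a b c d. i < length J \<longrightarrow> j < length J \<longrightarrow>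
      bil Y (w i a b) (w j c d) = (-1) ^ (a + b) * f i j (a + c) (b + d))"
      by (rule ex_invariant) (use l in \<open>auto simp: f_def min.commute\<close>)
    then obtain Y where Y: "invariant Y" "\<And>i j a b c d. i < length J \<Longrightarrow> j < length J \<Longrightarrow>
      bil Y (w i a b) (w j c d) = (-1) ^ (a + b) * f i j (a + c) (b + d)"
      by blast
    have fsym: "f j i s t = e * (-1) ^ (s + t) * f i j s t" for i j s t
    proof -
      have 1: "e * (-1) ^ (s + t) * (e * (-1) ^ (s + t)) = 1"
        using ee sgn[of "s + t"] by (simp add: mult_ac)
      have 2: "e * (-1) ^ (s + t) = 1" if "(i, i, s, t) = l"
        using l that ee by auto
      show ?thesis
        using 1 2 by (auto simp: f_def)
    qed
    have "transpose Y = mscale e Y"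
    proof (rule frame_bil_ext[OF w_frame])
      fix k k' assume kl: "k \<in> mod_index J" "k' \<in> mod_index J"
      obtain i a b j c d where *: "k = (i, a, b)" "k' = (j, c, d)"
        by (cases k, cases k') auto
      then have ij: "i < length J" "j < length J"
        using kl by (auto simp: mod_index_def)
      have "(-1) ^ (c + d) * f j i (a + c) (b + d) = 
          e * ((-1) ^ (c + d) * (-1) ^ (c + d)) * ((-1) ^ (a + b) * f i j (a + c) (b + d))"
        by (simp add: fsym[of j i] power_add mult_ac)
      then have "(-1) ^ (c + d) * f j i (a + c) (b + d) = e * ((-1) ^ (a + b) * f i j (a + c) (b + d))"
        by (simp only: sgn mult_1_right)
      then show "bil (transpose Y) (case k of (i, a, b) \<Rightarrow> w i a b) (case k' of (i, a, b) \<Rightarrow> w i a b) =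
        bil (mscale e Y) (case k of (i, a, b) \<Rightarrow> w i a b) (case k' of (i, a, b) \<Rightarrow> w i a b)"
        by (simp add: * bil_transpose bil_scale_mat Y ij add.commute[of c a] add.commute[of d b])
    qed
    moreover define X where "X = matrix_inv B ** Y"
    have BX: "B ** X = Y"
      by (simp add: X_def matrix_mul_assoc matrix_inv_inverse[OF B(1)])
    ultimately have "X \<in> ?S"
      unfolding S_iff BX using Y(1) by blast
    moreover have "?f k X = (if k = l then 1 else 0)" if k: "k \<in> ?K" for k
    proof -
      obtain i j s t where *: "k = (i, j, s, t)"
        by (cases k) auto
      have "?f k X = f i j s t"
        using k Y(2)[of i j 0 0 s t] by (simp add: * BX)
      also have "\<dots> = (if k = l then 1 else 0)"
        using k l by (auto simp: * f_def)
      finally show ?thesis .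
    qed
    ultimately show ?thesis
      by blast
  qed
  define b where "b l = (SOME X. X \<in> ?S \<and> (\<forall>k\<in>?K. ?f k X = (if k = l then 1 else 0)))" for l
  have b: "b l \<in> ?S \<and> (\<forall>k\<in>?K. ?f k (b l) = (if k = l then 1 else 0))" if "l \<in> ?K" for l
    unfolding b_def by (rule someI_ex[OF ex[OF that]])
  show ?thesis
  proof (rule mat.dim_eq_card_dual_functionals(2)[where f = ?f and b = b])
    show "finite ?K"
      by (rule finite_subset[of _ "{..<length J} \<times> {..<length J} \<times> (\<Union>i<length J. {..<nn i}) \<times> (\<Union>i<length J. {..<mm i})"]) auto
    show "X = 0" if X: "X \<in> ?S" and 0: "\<And>k. k \<in> ?K \<Longrightarrow> ?f k X = 0" for X
    proof -
      have inv: "invariant (B ** X)" and tr: "transpose (B ** X) = mscale e (B ** X)"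
        using X S_iff by blast+
      have swap: "bil (B ** X) (gen j) (w i s t) = e * (-1) ^ (s + t) * bil (B ** X) (gen i) (w j s t)" for i j s t
      proof -
        have "bil (B ** X) (w i s t) (gen j) = e * bil (B ** X) (gen j) (w i s t)"
          by (simp add: bil_transpose[of "B ** X" "gen j", symmetric] tr bil_scale_mat)
        then have "e * bil (B ** X) (gen j) (w i s t) = (-1) ^ (s + t) * bil (B ** X) (gen i) (w j s t)"
          using invariant_bil_w[OF inv, of i s t j 0 0] by simp
        then have "e * e * bil (B ** X) (gen j) (w i s t) = e * (-1) ^ (s + t) * bil (B ** X) (gen i) (w j s t)"
          by (simp add: mult.assoc)
        then show ?thesis
          by (simp add: ee)
      qed
      have "B ** X = 0"
      proof (rule invariant_eq_zero[OF inv])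
        fix i j s t assume *: "i < length J" "j < length J" "s < min (nn i) (nn j)" "t < min (mm i) (mm j)"
        consider "i < j" | "j < i" | "i = j" "e = (-1) ^ (s + t)" | "i = j" "e \<noteq> (-1) ^ (s + t)"
          by linarith
        then show "bil (B ** X) (gen i) (w j s t) = 0"
        proof cases
          case 1
          then show ?thesis using 0[of "(i, j, s, t)"] * by simp
        next
          case 2
          then show ?thesis using 0[of "(j, i, s, t)"] * swap[of i j s t] by simp
        next
          case 3
          then show ?thesis using 0[of "(i, j, s, t)"] * by simp
        next
          case 4
          \<comment> \<open>With the wrong parity, symmetry equates the parameter with its own
            negative.\<close>
          then have "e * (-1) ^ (s + t) = -1"
            using e by (cases "even (s + t)") auto
          then show ?thesis
            using swap[of i i s t] 4 by simp
        qed
      qed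
      then have "matrix_inv B ** (B ** X) = 0"
        by simp
      then show ?thesis
        by (simp add: matrix_mul_assoc matrix_inv_inverse[OF B(1)])
    qed
    show "?f k (X + Y) = ?f k X + ?f k Y" "?f k (mscale c X) = c * ?f k X" for k X Y c
      by (simp_all add: matrix_add_ldistrib bil_add_mat mscale_mult_right bil_scale_mat split: prod.split)
    show "b k \<in> ?S" if "k \<in> ?K" for k
      by (rule b[OF that, THEN conjunct1])
    show "?f k (b l) = (if k = l then 1 else 0)" if "k \<in> ?K" "l \<in> ?K" for k l
      by (rule bspec[OF b[OF that(2), THEN conjunct2] that(1)])
  qed (intro subspace_centralizer subspace_form_alg)
qed

text \<open>For a single summand, nondegeneracy forces the top coefficient \<open>B(gen, x ^ (n-1) y ^ (m-1) gen)\<close>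
  to be nonzero, which ties the symmetry type of \<open>B\<close> to the parity of \<open>n + m\<close>.\<close>

lemma single_summand_parity:
  assumes B: "invertible B" "invariant B" and sym: "transpose B = mscale (- e) B"
    and e: "e = 1 \<or> e = -1" and J: "length J = 1"
  shows "- e = (-1) ^ (nn 0 + mm 0)"
proof -
  let ?a = "nn 0 - 1" and ?b = "mm 0 - 1"
  have 0: "0 < length J"
    using J by simp
  have nm: "1 \<le> nn 0" "1 \<le> mm 0"
    using pos[OF 0] by auto
  have top: "w 0 ?a ?b \<noteq> 0"
  proof -
    obtain c where c: "c \<noteq> 0" "w 0 ?a ?b = c *s v (0, 0, 0)"
      using w_eq_v[OF 0, of ?a ?b] nm by auto
    have k: "(0, 0, 0) \<in> mod_index J"
      using 0 nm by (simp add: mod_index_def)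
    have "v (0, 0, 0) \<noteq> 0"
    proof
      assume "v (0, 0, 0) = 0"
      then have "frame_coord (mod_index J) v (0, 0, 0) (0 *s v (0, 0, 0)) = 1"
        using frame_coord_dual[OF fr k k] by simp
      then show False
        by (simp only: frame_coord_scale mult_zero_left zero_neq_one)
    qed
    then show ?thesis
      using c by simp
  qed
  have nz: "bil B (gen 0) (w 0 ?a ?b) \<noteq> 0"
  proof
    assume zero: "bil B (gen 0) (w 0 ?a ?b) = 0"
    \<comment> \<open>Moving the powers to the right raises the top monomial beyond its bounds, so
      only the generator itself could pair with it.\<close>
    have basis: "bil B (case k of (i, a, b) \<Rightarrow> w i a b) (w 0 ?a ?b) = 0" if k: "k \<in> mod_index J" for k
    proof -
      obtain a b where *: "k = (0, a, b)"
        using k J by (cases k) (auto simp: mod_index_def)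
      have "bil B (gen 0) (w 0 (a + ?a) (b + ?b)) = 0"
      proof (cases "a = 0 \<and> b = 0")
        case False
        then have "w 0 (a + ?a) (b + ?b) = 0"
          using nm by (intro w_zero[OF 0]) auto
        then show ?thesis by simp
      qed (use zero in simp)
      then show ?thesis
        by (simp add: * invariant_bil_w[OF B(2)])
    qed
    have "bil B u (w 0 ?a ?b) = 0" for u
    proof -
      have "bil B (\<Sum>k\<in>mod_index J. frame_coord (mod_index J) (\<lambda>(i, a, b). w i a b) k u *s
          (case k of (i, a, b) \<Rightarrow> w i a b)) (w 0 ?a ?b) = 0"
        unfolding bil_sum_left bil_scale_left by (intro sum.neutral ballI) (simp only: basis mult_zero_right)
      then show ?thesis
        by (simp only: frame_expand[OF w_frame])
    qed
    then show False
      using bil_nondegenerate_right[OF B(1)] top by blast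
  qed
  have s1: "bil B (gen 0) (w 0 ?a ?b) = - e * bil B (w 0 ?a ?b) (gen 0)"
    using bil_transpose[of B "w 0 ?a ?b" "gen 0"] by (simp add: sym bil_scale_mat bil_uminus_mat)
  have s2: "bil B (w 0 ?a ?b) (gen 0) = (-1) ^ (?a + ?b) * bil B (gen 0) (w 0 ?a ?b)"
    using invariant_bil_w[OF B(2), of 0 ?a ?b 0 0 0] by simp
  have "(- e * (-1) ^ (?a + ?b)) * bil B (gen 0) (w 0 ?a ?b) = 1 * bil B (gen 0) (w 0 ?a ?b)"
    by (simp only: mult.assoc s2[symmetric] s1[symmetric] mult_1)
  then have "- e * (-1) ^ (?a + ?b) = 1"
    by (rule mult_right_cancel[OF nz, THEN iffD1])
  moreover have "(-1 :: complex) ^ (nn 0 + mm 0) = (-1) ^ (?a + ?b)"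
    using nm by (cases "nn 0"; cases "mm 0") auto
  ultimately show ?thesis
    using e by (cases "even (?a + ?b)") auto
qed

end

section \<open>Counting\<close>

lemma card_parity_row: "card {t. t < m \<and> odd (s + t)} = (if even s then m div 2 else (m + 1) div 2)"
proof (induction m)
  case (Suc m)
  have "{t. t < Suc m \<and> odd (s + t)} = (if odd (s + m) then insert m else id) {t. t < m \<and> odd (s + t)}"
    by (auto simp: less_Suc_eq)
  then show ?case
    using Suc by (auto split: if_splits)
qed simp

text \<open>The black squares of a checkerboard, counted row by row with
  \<open>card_parity_row\<close>.\<close>

lemma card_odd_sum: "card {(s, t). s < n \<and> t < m \<and> odd (s + t)} = n * m div 2"
proof (induction n)
  case (Suc n)
  have eq: "{(s, t). s < Suc n \<and> t < m \<and> odd (s + t)} =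
    {(s, t). s < n \<and> t < m \<and> odd (s + t)} \<union> {n} \<times> {t. t < m \<and> odd (n + t)}"
    by (auto simp: less_Suc_eq)
  have fin: "finite {(s, t). s < n \<and> t < m \<and> odd (s + t)}"
    by (rule finite_subset[of _ "{..<n} \<times> {..<m}"]) auto
  have "card {(s, t). s < Suc n \<and> t < m \<and> odd (s + t)} =
      card {(s, t). s < n \<and> t < m \<and> odd (s + t)} + card {t. t < m \<and> odd (n + t)}"
    unfolding eq using fin by (subst card_Un_disjoint) (auto simp: card_cartesian_product)
  also have "\<dots> = n * m div 2 + (if even n then m div 2 else (m + 1) div 2)"
    unfolding Suc card_parity_row ..
  also have "\<dots> = Suc n * m div 2"
    by (cases "even n"; cases "even m") (auto elim!: evenE oddE simp: algebra_simps)
  finally show ?case .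
qed simp

lemma card_even_sum: "card {(s, t). s < n \<and> t < m \<and> even (s + t)} = (n * m + 1) div 2"
proof -
  let ?E = "{(s, t). s < n \<and> t < m \<and> even (s + t)}" and ?O = "{(s, t). s < n \<and> t < m \<and> odd (s + t)}"
  have fin: "finite ?E" "finite ?O"
    by (rule finite_subset[of _ "{..<n} \<times> {..<m}"]; auto)+
  have "{..<n} \<times> {..<m} = ?E \<union> ?O" "?E \<inter> ?O = {}"
    by auto
  then have "n * m = card ?E + card ?O"
    using card_Un_disjoint[OF fin] by (metis card_cartesian_product card_lessThan)
  moreover have "x = (y + 1) div 2" if "y = x + y div 2" for x y :: nat
    using that by presburger
  ultimately show ?thesis
    unfolding card_odd_sum by blast
qed

lemma card_mod_index: "card (mod_index J) = (\<Sum>i<length J. fst (J ! i) * snd (J ! i))"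
proof -
  have "mod_index J = (SIGMA i:{..<length J}. {..<fst (J ! i)} \<times> {..<snd (J ! i)})"
    by (auto simp: mod_index_def)
  then show ?thesis
    by (simp add: card_cartesian_product)
qed

context weight_basis
begin

text \<open>The number of free parameters of an invariant pairing between summands \<open>i\<close>
  and \<open>j\<close>; for \<open>i = j\<close> it is the dimension of the summand.\<close>

definition overlap :: "nat \<Rightarrow> nat \<Rightarrow> nat" where
  "overlap i j = min (nn i) (nn j) * min (mm i) (mm j)"

lemma overlap_pos: "i < length J \<Longrightarrow> j < length J \<Longrightarrow> 1 \<le> overlap i j"
  using pos[of i] pos[of j] by (simp add: overlap_def Suc_le_eq)

lemma CARD_eq_sum: "CARD('n) = (\<Sum>i<length J. nn i * mm i)"
  using fr card_mod_index[of J] by (simp add: frame_def)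

lemma J_nonempty: "0 < length J"
proof (rule ccontr)
  assume "\<not> 0 < length J"
  then have "CARD('n) = 0"
    unfolding CARD_eq_sum by simp
  then show False by simp
qed

lemma card_gl_index:
  "card {(i, j, s, t). i < length J \<and> j < length J \<and> s < min (nn i) (nn j) \<and> t < min (mm i) (mm j)} =
    (\<Sum>i<length J. \<Sum>j<length J. overlap i j)" (is "card ?K = _")
proof -
  have "?K = (SIGMA i:{..<length J}. SIGMA j:{..<length J}.
      {..<min (nn i) (nn j)} \<times> {..<min (mm i) (mm j)})"
    by auto
  then show ?thesis
    by (simp add: card_cartesian_product overlap_def)
qed

definition cross :: nat where
  "cross = (\<Sum>i<length J. \<Sum>j\<in>{i<..<length J}. overlap i j)"

lemma card_form_index:
  "card {(i, j, s, t). i \<le> j \<and> j < length J \<and> s < min (nn i) (nn j) \<and> t < min (mm i) (mm j) \<and>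
      (i = j \<longrightarrow> P (s + t))} =
    (\<Sum>i<length J. card {(s, t). s < nn i \<and> t < mm i \<and> P (s + t)}) + cross" (is "card ?K = _")
proof -
  define D where "D i j = {(s, t). s < min (nn i) (nn j) \<and> t < min (mm i) (mm j) \<and> (i = j \<longrightarrow> P (s + t))}" for i j
  have finD: "finite (D i j)" for i j
    by (rule finite_subset[of _ "{..<nn i} \<times> {..<mm i}"]) (auto simp: D_def)
  have D: "card (D i j) = overlap i j" if "i \<noteq> j" for i j
  proof -
    have "D i j = {..<min (nn i) (nn j)} \<times> {..<min (mm i) (mm j)}"
      using that by (auto simp: D_def)
    then show ?thesis
      by (simp add: card_cartesian_product overlap_def)
  qed
  have "?K = (SIGMA i:{..<length J}. SIGMA j:{i..<length J}. D i j)"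
    by (auto simp: D_def)
  then have "card ?K = (\<Sum>i<length J. \<Sum>j\<in>{i..<length J}. card (D i j))"
    by (simp add: finD)
  also have "\<dots> = (\<Sum>i<length J. card (D i i) + (\<Sum>j\<in>{i<..<length J}. overlap i j))"
  proof (rule sum.cong)
    fix i assume i: "i \<in> {..<length J}"
    then have "{i..<length J} = insert i {i<..<length J}"
      by auto
    then have "(\<Sum>j\<in>{i..<length J}. card (D i j)) = card (D i i) + (\<Sum>j\<in>{i<..<length J}. card (D i j))"
      by simp
    also have "(\<Sum>j\<in>{i<..<length J}. card (D i j)) = (\<Sum>j\<in>{i<..<length J}. overlap i j)"
      by (intro sum.cong D) auto
    finally show "(\<Sum>j\<in>{i..<length J}. card (D i j)) = card (D i i) + (\<Sum>j\<in>{i<..<length J}. overlap i j)" .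
  qed simp
  finally show ?thesis
    by (simp add: sum.distrib cross_def D_def)
qed

text \<open>With \<open>p\<close> summands and every overlap at least 1, the rows of indices 0 and 1
  alone contribute \<open>(p - 1) + (p - 2)\<close>.\<close>

lemma cross_lower_bound:
  assumes "2 \<le> length J"
  shows "2 * length J \<le> cross + 3"
proof -
  let ?f = "\<lambda>i. \<Sum>j\<in>{i<..<length J}. overlap i j"
  have f: "length J - Suc i \<le> ?f i" if "i < length J" for i
  proof -
    have "(\<Sum>j\<in>{i<..<length J}. 1) \<le> ?f i"
      using overlap_pos that by (intro sum_mono) auto
    then show ?thesis by simp
  qed
  have "(\<Sum>i\<in>{0, 1}. ?f i) \<le> cross"
    unfolding cross_def using assms by (intro sum_mono2) auto
  then have "?f 0 + ?f 1 \<le> cross"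
    by simp
  then show ?thesis
    using f[of 0] f[of 1] assms by linarith
qed

text \<open>The diagonal overlaps already add up to the dimension of \<open>V\<close>, so any
  off-diagonal term makes the count too large.\<close>

lemma gl_count_iff: "(\<Sum>i<length J. \<Sum>j<length J. overlap i j) = CARD('n) \<longleftrightarrow> length J = 1"
proof
  assume "length J = 1"
  then show "(\<Sum>i<length J. \<Sum>j<length J. overlap i j) = CARD('n)"
    unfolding CARD_eq_sum by (simp add: overlap_def)
next
  assume eq: "(\<Sum>i<length J. \<Sum>j<length J. overlap i j) = CARD('n)"
  show "length J = 1"
  proof (rule ccontr)
    assume "length J \<noteq> 1"
    then have p: "2 \<le> length J"
      using J_nonempty by linarith
    have "(\<Sum>i<length J. nn i * mm i) < (\<Sum>i<length J. \<Sum>j<length J. overlap i j)"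
    proof (rule sum_strict_mono)
      fix i assume i: "i \<in> {..<length J}"
      define j where "j = (if i = 0 then 1 else 0 :: nat)"
      have "(\<Sum>j\<in>{i, j}. overlap i j) \<le> (\<Sum>j<length J. overlap i j)"
        using i p by (intro sum_mono2) (auto simp: j_def)
      moreover have "(\<Sum>j\<in>{i, j}. overlap i j) = overlap i i + overlap i j"
        by (simp add: j_def)
      moreover have "1 \<le> overlap i j"
        using i p by (intro overlap_pos) (auto simp: j_def)
      moreover have "overlap i i = nn i * mm i"
        by (simp add: overlap_def)
      ultimately show "nn i * mm i < (\<Sum>j<length J. overlap i j)"
        by linarith
    qed (use J_nonempty in auto)
    then show False
      using eq CARD_eq_sum by simp
  qed
qed

text \<open>Halves are rounded up here, so the diagonal terms alone reach half the dimension and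
  \<open>cross\<close> must vanish. With one summand, equality means that nothing was
  rounded.\<close>

lemma even_count_iff:
  "(\<Sum>i<length J. (nn i * mm i + 1) div 2) + cross = CARD('n) div 2 \<longleftrightarrow>
    length J = 1 \<and> even (nn 0 * mm 0)"
proof (cases "length J = 1")
  case True
  then have "cross = 0"
    by (simp add: cross_def greaterThanLessThan_def greaterThan_def)
  moreover have "(x + 1) div 2 = x div 2 \<longleftrightarrow> even x" for x :: nat
    by presburger
  ultimately show ?thesis
    unfolding CARD_eq_sum using True by simp
next
  case False
  then have "1 \<le> cross"
    using J_nonempty cross_lower_bound by linarith
  moreover have "CARD('n) \<le> 2 * (\<Sum>i<length J. (nn i * mm i + 1) div 2)"
    unfolding CARD_eq_sum sum_distrib_left by (intro sum_mono) presburger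
  ultimately show ?thesis
    using False by linarith
qed

text \<open>Rounding down loses at most one half per summand, which \<open>cross\<close> has to make
  up exactly. For three or more summands its lower bound is too large; for two, both products must
  be odd and the overlap 1.\<close>

lemma odd_count_iff:
  "(\<Sum>i<length J. nn i * mm i div 2) + cross = CARD('n) div 2 \<longleftrightarrow>
    length J = 1 \<or> length J = 2 \<and> odd (nn 0 * mm 0) \<and> odd (nn 1 * mm 1) \<and> overlap 0 1 = 1"
proof -
  consider "length J = 1" | "length J = 2" | "3 \<le> length J"
    using J_nonempty by linarith
  then show ?thesis
  proof cases
    case 1
    then have "cross = 0"
      by (simp add: cross_def greaterThanLessThan_def greaterThan_def)
    then show ?thesis
      unfolding CARD_eq_sum using 1 by simp
  next
    case 2
    have "cross = overlap 0 1"
    proof -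
      have "{0<..<2} = {1 :: nat}" "{Suc 0<..<2} = {}"
        by auto
      then show ?thesis
        using 2 by (simp add: cross_def numeral_2_eq_2)
    qed
    moreover have "1 \<le> overlap 0 1"
      using 2 by (intro overlap_pos) auto
    moreover have "x div 2 + y div 2 + z = (x + y) div 2 \<longleftrightarrow> odd x \<and> odd y \<and> z = 1"
      if "1 \<le> z" for x y z :: nat
      using that by (cases "even x"; cases "even y") (auto elim!: evenE oddE)
    ultimately show ?thesis
      unfolding CARD_eq_sum using 2 by (simp add: numeral_2_eq_2)
  next
    case 3
    have "CARD('n) \<le> (\<Sum>i<length J. 2 * (nn i * mm i div 2) + 1)"
      unfolding CARD_eq_sum by (intro sum_mono) presburger
    then have "CARD('n) \<le> 2 * (\<Sum>i<length J. nn i * mm i div 2) + length J"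
      by (simp only: sum.distrib sum_distrib_left sum_constant card_lessThan) simp
    then show ?thesis
      using cross_lower_bound 3 by linarith
  qed
qed

end

text \<open>Overlap 1 means that some \<open>n\<close> and some \<open>m\<close> equal 1. If they
  belong to the same summand, that summand is \<open>(1, 1)\<close>; otherwise the summands are
  \<open>(n, 1)\<close> and \<open>(1, m)\<close>.\<close>

lemma pair_condition_iff:
  fixes n0 m0 n1 m1 :: nat
  shows "(\<exists>n m. odd n \<and> odd m \<and> (mset [(n0, m0), (n1, m1)] = {#(n, m), (1, 1)#} \<or>
      mset [(n0, m0), (n1, m1)] = {#(n, 1), (1, m)#})) \<longleftrightarrow>
    odd (n0 * m0) \<and> odd (n1 * m1) \<and> min n0 n1 * min m0 m1 = 1"
proof -
  have two: "mset [x, y] = {#p, q#} \<longleftrightarrow> x = p \<and> y = q \<or> x = q \<and> y = p" for x y p q :: "nat \<times> nat"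
    by (auto simp: add_eq_conv_ex)
  have "min n0 n1 * min m0 m1 = 1 \<longleftrightarrow> (n0 = 1 \<and> 1 \<le> n1 \<or> n1 = 1 \<and> 1 \<le> n0) \<and> (m0 = 1 \<and> 1 \<le> m1 \<or> m1 = 1 \<and> 1 \<le> m0)"
    by (auto simp: min_def)
  moreover have "odd x \<Longrightarrow> 1 \<le> x" for x :: nat
    by (cases x) auto
  ultimately show ?thesis
    unfolding two by auto
qed

theorem theorem8p5:
  fixes k :: classical and B :: "'n::finite cmat"
    and E1 H1 F1 E2 H2 F2 :: "'n cmat" and J :: "(nat \<times> nat) list"
  assumes "admissible_form k B"
    and "sl2sl2_hom (lie_alg k B) E1 H1 F1 E2 H2 F2"
    and "decomposes_as E1 H1 F1 E2 H2 F2 J"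
  shows "principal_nilpotent_pair (lie_alg k B) (lie_grp k B) E1 E2 \<longleftrightarrow> pnp_condition k J"
proof -
  obtain v where "weight_basis E1 H1 E2 H2 J v"
    using decomposes_as_weight_basis[OF assms(3)] .
  then interpret weight_basis E1 H1 E2 H2 J v .
  have L: "E1 \<in> lie_alg k B" "E2 \<in> lie_alg k B" "H1 \<in> lie_alg k B" "H2 \<in> lie_alg k B"
    using assms(2) by (auto simp: sl2sl2_hom_def)
  have form: "lie_alg k B = form_alg B" if "k \<noteq> SL"
    using that by (cases k) (auto simp: lie_alg_def form_alg_def)
  have "\<exists>g\<in>lie_grp k B. Ad g E1 = mscale t1 E1 \<and> Ad g E2 = mscale t2 E2"
    if t: "t1 \<noteq> 0 \<and> t2 \<noteq> 0" for t1 t2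
  proof -
    obtain g where g: "det g = 1" "Ad g E1 = mscale t1 E1" "Ad g E2 = mscale t2 E2"
      "\<And>B. H1 \<in> form_alg B \<Longrightarrow> H2 \<in> form_alg B \<Longrightarrow> transpose g ** B ** g = B"
      using ex_torus_element[OF t[THEN conjunct1] t[THEN conjunct2]] by blast
    have "g \<in> lie_grp k B"
      using g L form by (cases k) (auto simp: lie_grp_def)
    then show ?thesis
      using g by blast
  qed
  \<comment> \<open>Commutation and the torus elements settle every condition except the dimension
    of the centralizer.\<close>
  then have "principal_nilpotent_pair (lie_alg k B) (lie_grp k B) E1 E2 \<longleftrightarrow>
      mat.dim (centralizer (lie_alg k B) {E1, E2}) = lie_rank (lie_alg k B)"
    using L by (auto simp: principal_nilpotent_pair_def bracket_def E_commute cdim_eq)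
  also have "\<dots> \<longleftrightarrow> pnp_condition k J"
  proof (cases k)
    case SL
    then have sl: "lie_alg k B = {X. trace X = 0}"
      by (simp add: lie_alg_def)
    have "Suc (mat.dim (centralizer {X :: 'n cmat. trace X = 0} {E1, E2})) =
        (\<Sum>i<length J. \<Sum>j<length J. overlap i j)"
      using dim_centralizer_gl card_gl_index dim_centralizer_trace_zero[of "{E1, E2}"] by simp
    \<comment> \<open>The subtraction is not truncated, since \<open>CARD('n)\<close> is
      positive.\<close>
    moreover have "d = CARD('n) - 1 \<longleftrightarrow> Suc d = CARD('n)" for d
      using zero_less_card_finite[where ?'a = 'n] by linarith
    ultimately have "mat.dim (centralizer (lie_alg k B) {E1, E2}) = lie_rank (lie_alg k B) \<longleftrightarrow>
        (\<Sum>i<length J. \<Sum>j<length J. overlap i j) = CARD('n)"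
      unfolding sl lie_rank_trace_zero by presburger
    then show ?thesis
      using gl_count_iff SL by (simp add: pnp_condition_def)
  next
    case SP
    have B: "invertible B" "transpose B = mscale (- 1) B"
      using assms(1) SP by (simp_all add: admissible_form_def mscale_uminus_one)
    have inv: "invariant B"
      using L form SP by (simp add: invariant_def)
    have sym: "bil B u w = -1 * bil B w u" for u w
      using bil_transpose[of B w u] by (simp add: B(2) bil_uminus_mat mscale_uminus_one)
    have rank: "lie_rank (form_alg B) = CARD('n) div 2"
      by (rule lie_rank_form_alg[OF B(1) sym]) simp
    have par: "(1 :: complex) = (-1) ^ x \<longleftrightarrow> even x" for x :: nat
      by (cases "even x") auto
    have "mat.dim (centralizer (form_alg B) {E1, E2}) = (\<Sum>i<length J. (nn i * mm i + 1) div 2) + cross"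
      using dim_centralizer_form_alg[OF B(1) inv B(2)] unfolding par card_form_index card_even_sum
      by simp
    \<comment> \<open>For one summand the existence of the skew form already forces different
      parities, which makes \<open>nn 0 * mm 0\<close> even.\<close>
    moreover have "odd (nn 0 + mm 0)" if "length J = 1"
      using single_summand_parity[OF B(1) inv B(2) _ that] by (cases "even (nn 0 + mm 0)") auto
    ultimately show ?thesis
      using even_count_iff rank form SP by (auto simp: pnp_condition_def)
  next
    case SO
    \<comment> \<open>The double negation matches the pattern \<open>mscale (- e) B\<close> with
      \<open>e = -1\<close>.\<close>
    have B: "invertible B" "transpose B = mscale (- (- 1)) B"
      using assms(1) SO by (simp_all add: admissible_form_def)
    have inv: "invariant B"
      using L form SO by (simp add: invariant_def)
    have sym: "bil B u w = 1 * bil B w u" for u w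
      using bil_transpose[of B u w] B(2) by simp
    have rank: "lie_rank (form_alg B) = CARD('n) div 2"
      by (rule lie_rank_form_alg[OF B(1) sym]) simp
    have par: "(-1 :: complex) = (-1) ^ x \<longleftrightarrow> odd x" for x :: nat
      by (cases "even x") auto
    have "mat.dim (centralizer (form_alg B) {E1, E2}) = (\<Sum>i<length J. nn i * mm i div 2) + cross"
      using dim_centralizer_form_alg[OF B(1) inv B(2)] unfolding par card_form_index[of odd] card_odd_sum
      by simp
    then have "mat.dim (centralizer (lie_alg k B) {E1, E2}) = lie_rank (lie_alg k B) \<longleftrightarrow>
      length J = 1 \<or> length J = 2 \<and> odd (nn 0 * mm 0) \<and> odd (nn 1 * mm 1) \<and> overlap 0 1 = 1"
      using odd_count_iff rank form SO by simp
    \<comment> \<open>For one summand the dimension count always agrees, and equal parity is forced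
      by the symmetric form.\<close>
    moreover have "even (nn 0 + mm 0)" if "length J = 1"
      using single_summand_parity[OF B(1) inv B(2) _ that] by (cases "even (nn 0 + mm 0)") auto
    moreover have "odd (nn 0 * mm 0) \<and> odd (nn 1 * mm 1) \<and> overlap 0 1 = 1 \<longleftrightarrow>
        (\<exists>n m. odd n \<and> odd m \<and> (mset J = {#(n, m), (1, 1)#} \<or> mset J = {#(n, 1), (1, m)#}))"
      if len: "length J = 2"
    proof -
      obtain n0 m0 n1 m1 where "J = [(n0, m0), (n1, m1)]"
        using len by (cases J; cases "tl J") auto
      then show ?thesis
        unfolding overlap_def using pair_condition_iff[of n0 m0 n1 m1] by simp
    qed
    ultimately show ?thesis
      using SO by (auto simp: pnp_condition_def)
  qed
  finally show ?thesis .
qed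

end
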